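(* Let $\omega>0$, $\mu>0$, $f_0\in(0,1)$, $\lambda>0$, and let $\lambda_1$, $\lambda_2$ and the problem $P(\lambda,f)$ be as defined in the context. (i) If $\lambda<\lambda_2$, then there exists a unique solution $u^*_{\lambda,\mu}$ without free boundary of $P(\lambda,f)$. Moreover $u^*_{\lambda,\mu}$ is monotone and $$\|u^*_{\lambda,\mu}\|_\infty=u^*_{\lambda,\mu}(0)=-\frac{\lambda f_0}{\omega^2\cosh\omega}+\frac{\lambda f_0}{\omega^2}<\mu,$$ i.e. the line $(\lambda,\gamma^*(\lambda))$ with $\gamma^*(\lambda):=\frac{\lambda f_0(\cosh\omega-1)}{\omega^2\cosh\omega}$, $\lambda\in(0,\lambda_2)$, defines an increasing part of the $\lambda$-bifurcation diagram. (ii) If $\lambda=\lambda_1$, then there exists a unique monotone solution $u_{\lambda_1}$ of $P(\lambda,f)$ giving rise to a free boundary. Moreover $u_{\lambda_1}$ is strictly concave and $u_{\lambda_1}(0)=\mu$. (iii) If $\lambda\in(\lambda_1,\lambda_2]$, then there exists a monotone solution $\underline{u}_{\lambda,\mu}$ of $P(\lambda,f)$ with a free boundary $\underline{x}_{\lambda,\mu}\in(0,r^* )$, where $r^*\in(0,1)$ is such that $u_{\lambda,\mu}(r^* )=\mu$. Moreover, $$\|\underline{u}_{\lambda,\mu}\|_\infty=\underline{u}_{\lambda,\mu}(0)=\frac{\mu\omega^2-\lambda}{\omega^2\cosh(\omega\underline{x}_{\lambda,\mu})}+\frac{\lambda}{\omega^2}=:\underline{\gamma}(\lambda).$$ (iv)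 If $\lambda\in(\lambda_1,+\infty)$, then there exists a monotone solution $\overline{u}_{\lambda,\mu}$ of $P(\lambda,f)$ such that $\mu<\|\overline{u}_{\lambda,\mu}\|_\infty$, and $\|\underline{u}_{\lambda,\mu}\|_\infty<\|\overline{u}_{\lambda,\mu}\|_\infty$ if $\lambda\in(\lambda_1,\lambda_2]$. Moreover its free boundary is given by $\overline{x}_{\lambda,\mu}\in(r^*,1)$, with $r^*\in(0,1)$ as in (iii), and $$\|\overline{u}_{\lambda,\mu}\|_\infty=\overline{u}_{\lambda,\mu}(0)=\frac{\mu\omega^2-\lambda}{\omega^2\cosh(\omega\overline{x}_{\lambda,\mu})}+\frac{\lambda}{\omega^2}=:\overline{\gamma}(\lambda).$$ (v) The $\lambda$-bifurcation curve is S-shaped, i.e. it is a continuous curve of $\lambda$ such that $\gamma^*(\lambda)$ and $\overline{\gamma}(\lambda)$ are increasing functions of $\lambda$ and $\underline{\gamma}(\lambda)$ is a decreasing function of $\lambda$.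
   Context: Let $f(v)=f_0+(1-f_0)H(v-\mu)$, where $H(s)=0$ for $s<0$ and $H(s)=1$ for $s\ge 0$. Problem $P(\lambda,f)$ is $$-u''(x)+\omega^2u(x)=\lambda f(u(x)),\ x\in(0,1),\qquad u'(0)=0,\quad u(1)=0.$$ A solution $u_{\lambda,\mu}$ of $P(\lambda,f)$ is a function $u\in C^2((0,1)\setminus\{x_{\lambda,\mu}\})\cap C^1([0,1))$, for some $x_{\lambda,\mu}\in[0,1)$ with $u(x_{\lambda,\mu})=\mu$ (called the free boundary associated to $u$), with $u\ge0$, $u\ne0$, satisfying the equation for every $x\in(0,1)\setminus\{x_{\lambda,\mu}\}$ and the boundary conditions $u'(0)=0$, $u(1)=0$. A solution without free boundary is a function $u\ge0$, $u\ne0$, satisfying the equation on $(0,1)$ and the boundary conditions, with $f(u(x))=f_0$ for every $x\in[0,1]$. A solution $u$ is monotone if $u'(x)\le0$ for every $x\in(0,1)$. We write $\|u\|_\infty=\max_{x\in[0,1]}|u(x)|$. The $\lambda$-bifurcation diagram (or curve) is the set of pairs $(\lambda,\|u\|_\infty)$ with $u$ a monotone solution of $P(\lambda,f)$. The two values of the parameter are $$\lambda_1:=\mu\,\frac{\omega^2\cosh\omega}{\sinh(\omega\kappa)\sinh(\omega-\omega\kappa)-f_0\cosh(\omega\kappa)+f_0\cosh(\omega\kappa)\cosh(\omega-\omega\kappa)},\qquad \lambda_2:=\mu\,\frac{\omega^2\cosh\omega}{f_0(\cosh\omega-1)},$$ where $\kappa=\kappa(f_0)=r^*$ is the unique $r^*\in(0,1)$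 satisfying $$r^*=\frac{m_{f_0}(r^* )+1}{2},\qquad m_{f_0}(r):=\frac1\omega\sinh^{-1}\!\Big(\frac{f_0}{f_0-1}\sinh(\omega r)\Big).$$
   Formalization: In (ii), u_{λ1}(0)=μ is false and becomes u_{λ1}(0)>μ; u_{λ1} is strictly concave on [0,r*], and on [0,1] iff μω²≤λ1·f0. In (iii), the free boundary at λ=λ2 is 0, not in (0,r* ). Solutions are taken continuous on [0,1]. *)

theory Defs
  imports "HOL-Analysis.Analysis"
begin

definition heaviside :: "real \<Rightarrow> real" where
  "heaviside s = (if s < 0 then 0 else 1)"

definition coalb :: "real \<Rightarrow> real \<Rightarrow> real \<Rightarrow> real" where
  "coalb f0 \<mu> v = f0 + (1 - f0) * heaviside (v - \<mu>)"

text \<open>Derivatives are taken within the set, so that on \<open>[0,1)\<close> the derivative at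
  \<open>0\<close> is the one-sided one; functions are total and are only looked at on \<open>[0,1]\<close>.\<close>

definition C1_on :: "(real \<Rightarrow> real) \<Rightarrow> real set \<Rightarrow> bool" where
  "C1_on u S \<longleftrightarrow> (\<exists>u'. (\<forall>x\<in>S. (u has_real_derivative u' x) (at x within S)) \<and>
                        continuous_on S u')"

definition C2_on :: "(real \<Rightarrow> real) \<Rightarrow> real set \<Rightarrow> bool" where
  "C2_on u S \<longleftrightarrow> (\<exists>u'. (\<forall>x\<in>S. (u has_real_derivative u' x) (at x within S)) \<and> C1_on u' S)"

definition strict_concave_on :: "real set \<Rightarrow> (real \<Rightarrow> real) \<Rightarrow> bool" where
  "strict_concave_on S u \<longleftrightarrow> convex S \<and>
     (\<forall>x\<in>S. \<forall>y\<in>S. \<forall>t. x \<noteq> y \<and> 0 < t \<and> t < 1 \<longrightarrow>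
        (1 - t) * u x + t * u y < u ((1 - t) * x + t * y))"

definition satisfies_ode_on ::
  "real \<Rightarrow> real \<Rightarrow> real \<Rightarrow> real \<Rightarrow> real set \<Rightarrow> (real \<Rightarrow> real) \<Rightarrow> bool" where
  "satisfies_ode_on \<omega> \<mu> f0 l S u \<longleftrightarrow>
     (\<forall>x\<in>S. - deriv (deriv u) x + \<omega>\<^sup>2 * u x = l * coalb f0 \<mu> (u x))"

text \<open>Continuity on the closed interval is part of the meaning of \<open>u(1) = 0\<close> and of
  \<open>\<parallel>u\<parallel>\<^sub>\<infinity>\<close> as a maximum; \<open>C\<^sup>1([0,1))\<close> alone would leave \<open>u(1)\<close> unrelated to
  the values of \<open>u\<close> on \<open>[0,1)\<close>.\<close>

definition admissible :: "(real \<Rightarrow> real) \<Rightarrow> bool" where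
  "admissible u \<longleftrightarrow>
     C1_on u {0..<1} \<and> continuous_on {0..1} u \<and>
     (\<forall>x\<in>{0..1}. 0 \<le> u x) \<and> (\<exists>x\<in>{0..1}. u x \<noteq> 0) \<and>
     (u has_real_derivative 0) (at 0 within {0..<1}) \<and> u 1 = 0"

definition fb_solution ::
  "real \<Rightarrow> real \<Rightarrow> real \<Rightarrow> real \<Rightarrow> (real \<Rightarrow> real) \<Rightarrow> real \<Rightarrow> bool" where
  "fb_solution \<omega> \<mu> f0 l u xf \<longleftrightarrow>
     xf \<in> {0..<1} \<and> u xf = \<mu> \<and> admissible u \<and> C2_on u ({0<..<1} - {xf}) \<and>
     satisfies_ode_on \<omega> \<mu> f0 l ({0<..<1} - {xf}) u"

definition nofb_solution ::
  "real \<Rightarrow> real \<Rightarrow> real \<Rightarrow> real \<Rightarrow> (real \<Rightarrow> real) \<Rightarrow> bool" where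
  "nofb_solution \<omega> \<mu> f0 l u \<longleftrightarrow>
     admissible u \<and> C2_on u {0<..<1} \<and> satisfies_ode_on \<omega> \<mu> f0 l {0<..<1} u \<and>
     (\<forall>x\<in>{0..1}. coalb f0 \<mu> (u x) = f0)"

definition monotone_sol :: "(real \<Rightarrow> real) \<Rightarrow> bool" where
  "monotone_sol u \<longleftrightarrow> (\<forall>x\<in>{0<..<1}. deriv u x \<le> 0)"

definition supnorm :: "(real \<Rightarrow> real) \<Rightarrow> real" where
  "supnorm u = (SUP x\<in>{0..1}. \<bar>u x\<bar>)"

definition bifurcation_diagram :: "real \<Rightarrow> real \<Rightarrow> real \<Rightarrow> (real \<times> real) set" where
  "bifurcation_diagram \<omega> \<mu> f0 =
     {(l, supnorm u) | l u. 0 < l \<and> monotone_sol u \<and>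
        (nofb_solution \<omega> \<mu> f0 l u \<or> (\<exists>xf. fb_solution \<omega> \<mu> f0 l u xf))}"

definition m_fun :: "real \<Rightarrow> real \<Rightarrow> real \<Rightarrow> real" where
  "m_fun \<omega> f0 r = 1 / \<omega> * arsinh (f0 / (f0 - 1) * sinh (\<omega> * r))"

definition rstar :: "real \<Rightarrow> real \<Rightarrow> real" where
  "rstar \<omega> f0 = (THE r. 0 < r \<and> r < 1 \<and> r = (m_fun \<omega> f0 r + 1) / 2)"

definition lam1 :: "real \<Rightarrow> real \<Rightarrow> real \<Rightarrow> real" where
  "lam1 \<omega> \<mu> f0 = (let k = rstar \<omega> f0 in
     \<mu> * (\<omega>\<^sup>2 * cosh \<omega> /
       (sinh (\<omega> * k) * sinh (\<omega> - \<omega> * k) - f0 * cosh (\<omega> * k)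
         + f0 * cosh (\<omega> * k) * cosh (\<omega> - \<omega> * k))))"

definition lam2 :: "real \<Rightarrow> real \<Rightarrow> real \<Rightarrow> real" where
  "lam2 \<omega> \<mu> f0 = \<mu> * (\<omega>\<^sup>2 * cosh \<omega> / (f0 * (cosh \<omega> - 1)))"

definition gamma_star :: "real \<Rightarrow> real \<Rightarrow> real \<Rightarrow> real" where
  "gamma_star \<omega> f0 l = l * f0 * (cosh \<omega> - 1) / (\<omega>\<^sup>2 * cosh \<omega>)"

text \<open>The value at \<open>0\<close> of a monotone solution with free boundary \<open>xf\<close>.\<close>

definition gamma_fb :: "real \<Rightarrow> real \<Rightarrow> real \<Rightarrow> real \<Rightarrow> real" where
  "gamma_fb \<omega> \<mu> l xf = (\<mu> * \<omega>\<^sup>2 - l) / (\<omega>\<^sup>2 * cosh (\<omega> * xf)) + l / \<omega>\<^sup>2"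

text \<open>A planar curve without endpoints and without self-intersections, parametrised by
  \<open>(0,\<infinity>)\<close>.\<close>

definition continuous_curve :: "(real \<times> real) set \<Rightarrow> bool" where
  "continuous_curve B \<longleftrightarrow>
     (\<exists>p :: real \<Rightarrow> real \<times> real. continuous_on {0<..} p \<and> inj_on p {0<..} \<and> p ` {0<..} = B)"

lemma rstar_ex1:
  fixes \<omega> f0 :: real
  assumes "0 < \<omega>" "0 < f0" "f0 < 1"
  shows "\<exists>!r. 0 < r \<and> r < 1 \<and> r = (m_fun \<omega> f0 r + 1) / 2"
proof -
  define g where "g r = sinh (\<omega> * (2 * r - 1)) - f0 / (f0 - 1) * sinh (\<omega> * r)" for r :: real
  have eq: "r = (m_fun \<omega> f0 r + 1) / 2 \<longleftrightarrow> g r = 0" for r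
  proof -
    have "r = (m_fun \<omega> f0 r + 1) / 2 \<longleftrightarrow>
        \<omega> * (2 * r - 1) = arsinh (f0 / (f0 - 1) * sinh (\<omega> * r))"
      using assms by (auto simp: m_fun_def field_simps)
    also have "\<dots> \<longleftrightarrow> g r = 0"
      unfolding g_def by (metis sinh_arsinh_real arsinh_sinh_real eq_iff_diff_eq_0)
    finally show ?thesis .
  qed
  have c: "f0 / (f0 - 1) < 0" using assms by (simp add: divide_pos_neg)
  have mono: "g r < g s" if "r < s" for r s
  proof -
    have "sinh (\<omega> * (2 * r - 1)) < sinh (\<omega> * (2 * s - 1))" "sinh (\<omega> * r) < sinh (\<omega> * s)"
      using that assms by simp_all
    then show ?thesis unfolding g_def using mult_strict_left_mono_neg[OF _ c] by (smt (verit))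
  qed
  have g0: "g 0 < 0" using assms by (simp add: g_def)
  have g1: "g 1 > 0" using assms c by (simp add: g_def mult_neg_pos)
       (smt (verit) c mult_neg_pos sinh_real_pos_iff times_divide_eq_left)
  have "\<exists>r. 0 \<le> r \<and> r \<le> 1 \<and> g r = 0"
    by (rule IVT') (use g0 g1 assms in \<open>auto simp: g_def intro!: continuous_intros\<close>)
  then obtain r where r: "0 \<le> r" "r \<le> 1" "g r = 0" by blast
  with g0 g1 have "0 < r" "r < 1" by (metis less_irrefl order_le_less)+
  with r show ?thesis unfolding eq
    by (intro ex1I[of _ r]) (auto, metis mono less_irrefl linorder_neqE)
qed

end

theory Submission
  imports Defs
begin

text \<open>On each side of its free boundary \<open>s\<close> a monotone solution solves a linear equation, so \<open>u'(0) = 0\<close>,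
  \<open>u(s) = \<mu>\<close> and \<open>C\<^sup>1\<close>-matching determine it explicitly (\<open>profile\<close>), and \<open>u(1) = 0\<close> becomes
  \<open>\<lambda> = \<Lambda>(s) = \<mu> \<omega>\<^sup>2 cosh \<omega> / D(s)\<close>. Hence the free boundary solutions are parametrised by \<open>s \<in> [0,1)\<close>.
  The function \<open>D\<close> increases on \<open>[0,r\<^sup>*]\<close> and decreases to \<open>0\<close> on \<open>[r\<^sup>*,1]\<close>, so \<open>\<Lambda>\<close> falls from \<open>\<lambda>\<^sub>2\<close> to \<open>\<lambda>\<^sub>1\<close>
  and then rises to infinity, while the norm \<open>\<Gamma>(s)\<close> is strictly increasing on all of \<open>[0,1)\<close>. Together with
  the line of solutions below \<open>\<mu>\<close>, which ends at \<open>(\<lambda>\<^sub>2, \<mu>)\<close>, this is the S-shaped curve.\<close>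

subsection \<open>Calculus on the interval\<close>

text \<open>\<open>\<Lambda>\<close> turns at \<open>r\<close>, so \<open>\<lambda>\<close> cannot
  parametrise the free boundary solutions, and a turning point alone says nothing about the norm.
  The decisive estimate is that \<open>\<Gamma>\<close> increases through \<open>r\<close>: the norm
  then falls with \<open>\<lambda>\<close> where \<open>\<Lambda>\<close> decreases and rises where
  it increases, and the curve cannot meet itself. A second obstacle is that a free boundary is only
  required to satisfy \<open>u s = \<mu>\<close>. Monotonicity settles the side left of
  \<open>s\<close>, but a priori \<open>u\<close> might remain on the level \<open>\<mu>\<close>
  beyond it, and then no linear equation with right-hand side \<open>l * f0\<close> would be
  available; the jump of the Heaviside function at \<open>\<mu>\<close> rules this out. Finally, the
  free boundary branch has norm \<open>\<mu>\<close> only for \<open>s = 0\<close>, at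
  \<open>\<Lambda> 0\<close>, whereas the fold at \<open>\<Lambda> r\<close> has
  \<open>s = r > 0\<close> and a norm above \<open>\<mu>\<close>. The claims about the fold and
  those about the solution with maximum \<open>\<mu>\<close> therefore concern different values of
  \<open>\<lambda>\<close>.\<close>

lemma exI5: "P a b c d e \<Longrightarrow> \<exists>a b c d e. P a b c d e"
  by blast

text \<open>The derivative hidden in \<open>C1_on\<close> is taken within \<open>{0..<1}\<close>.
  Interior points make it two-sided, and uniqueness of one-sided derivatives at 0 turns the Neumann
  condition into \<open>u' 0 = 0\<close>.\<close>

lemma C1_on_deriv_at_0:
  assumes "C1_on u {0..<1}" "(u has_real_derivative 0) (at 0 within {0..<1})"
  obtains u' where "\<And>x. x \<in> {0<..<1} \<Longrightarrow> (u has_real_derivative u' x) (at x)"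
    "continuous_on {0..<1} u'" "u' 0 = 0"
proof -
  from assms(1)[unfolded C1_on_def] obtain u' where
    u': "\<forall>x\<in>{0..<1}. (u has_real_derivative u' x) (at x within {0..<1})" "continuous_on {0..<1} u'"
    by (elim exE conjE)
  have "(u has_real_derivative u' x) (at x)" if "x \<in> {0<..<1}" for x
  proof -
    have "x \<in> interior {0..<1}" using that by (simp add: interior_atLeastLessThan)
    then show ?thesis using bspec[OF u'(1), of x] that at_within_interior[of x "{0..<1}"] by auto
  qed
  moreover have "u' 0 = 0"
  proof (rule has_field_derivative_unique)
    show "(u has_real_derivative u' 0) (at 0 within {0..<1})" using bspec[OF u'(1), of 0] by simp
    show "(u has_real_derivative 0) (at 0 within {0..<1})" by fact
    show "at (0::real) within {0..<1} \<noteq> bot"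
      by (simp add: trivial_limit_within islimpt_Ico)
  qed
  ultimately show thesis using u' by (intro that[of u']) auto
qed

text \<open>The equation is phrased with iterated \<open>deriv\<close>, the regularity with
  existential witnesses; on an open set the two must coincide.\<close>

lemma C2_on_openD:
  assumes "open S" "C2_on u S"
  shows "x \<in> S \<Longrightarrow> (deriv u has_real_derivative deriv (deriv u) x) (at x)"
    and "continuous_on S (deriv (deriv u))"
proof -
  obtain d d' where d: "\<And>x. x \<in> S \<Longrightarrow> (u has_real_derivative d x) (at x within S)"
    "\<And>x. x \<in> S \<Longrightarrow> (d has_real_derivative d' x) (at x within S)" "continuous_on S d'"
    using assms(2) unfolding C2_on_def C1_on_def by blast
  have du: "deriv u x = d x" if "x \<in> S" for x
    using d(1) that assms(1) by (metis at_within_open DERIV_imp_deriv)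
  have dd: "(deriv u has_real_derivative d' x) (at x)" if "x \<in> S" for x
    using d(2)[OF that] that assms(1) du
    by (metis at_within_open has_field_derivative_transform_within_open)
  show "x \<in> S \<Longrightarrow> (deriv u has_real_derivative deriv (deriv u) x) (at x)"
    using dd DERIV_imp_deriv by metis
  have "continuous_on S (deriv (deriv u)) \<longleftrightarrow> continuous_on S d'"
    by (rule continuous_on_cong) (auto simp: DERIV_imp_deriv[OF dd])
  then show "continuous_on S (deriv (deriv u))" using d(3) by simp
qed

text \<open>One gluing lemma for both orders: matching is demanded only at \<open>x = s\<close>, so
  it gives the derivative of \<open>profile\<close> everywhere and that of \<open>profile'\<close>
  off \<open>s\<close>.\<close>

lemma DERIV_If_le:
  fixes f g :: "real \<Rightarrow> real"
  assumes f: "\<And>x. DERIV f x :> f' x" and g: "\<And>x. DERIV g x :> g' x"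
    and s: "x = s \<Longrightarrow> f s = g s \<and> f' s = g' s"
  shows "DERIV (\<lambda>x. if x \<le> s then f x else g x) x :> (if x \<le> s then f' x else g' x)"
proof -
  let ?h = "\<lambda>x. if x \<le> s then f x else g x"
  consider "x < s" | "s < x" | "x = s" by linarith
  then show ?thesis
  proof cases
    case 1
    then have "DERIV ?h x :> f' x"
      by (intro has_field_derivative_transform_within_open[OF f, of "{..<s}"]) auto
    then show ?thesis using 1 by simp
  next
    case 2
    then have "DERIV ?h x :> g' x"
      by (intro has_field_derivative_transform_within_open[OF g, of "{s<..}"]) auto
    then show ?thesis using 2 by simp
  next
    case 3
    have "((\<lambda>y. (?h y - ?h s) / (y - s)) \<longlongrightarrow> f' s) (at_left s)"
      using f[of s] unfolding has_field_derivative_iff filterlim_at_split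
      by (auto elim!: tendsto_cong[THEN iffD1, rotated] simp: eventually_at_filter)
    moreover have "((\<lambda>y. (?h y - ?h s) / (y - s)) \<longlongrightarrow> f' s) (at_right s)"
      using g[of s] s 3 unfolding has_field_derivative_iff filterlim_at_split
      by (auto elim!: tendsto_cong[THEN iffD1, rotated] simp: eventually_at_filter)
    ultimately show ?thesis
      unfolding has_field_derivative_iff filterlim_at_split using 3 by simp
  qed
qed

text \<open>The two combinations of \<open>v = u - k / \<omega>\<^sup>2\<close> and \<open>u'\<close> in the proof are first integrals
  of \<open>v'' = \<omega>\<^sup>2 v\<close>.\<close>

lemma linear_ode_solution:
  fixes u u' :: "real \<Rightarrow> real"
  assumes "\<omega> \<noteq> 0" "a < b"
    and cu: "continuous_on {a..b} u" and cu': "continuous_on {a..<b} u'"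
    and du: "\<And>x. a < x \<Longrightarrow> x < b \<Longrightarrow> DERIV u x :> u' x"
    and du': "\<And>x. a < x \<Longrightarrow> x < b \<Longrightarrow> DERIV u' x :> \<omega>\<^sup>2 * u x - k"
    and x: "x \<in> {a..b}"
  shows "u x = (u a - k / \<omega>\<^sup>2) * cosh (\<omega> * (x - a)) + u' a / \<omega> * sinh (\<omega> * (x - a)) + k / \<omega>\<^sup>2"
proof -
  define c where "c = 1 / \<omega>"
  have c: "c * \<omega> = 1" using assms(1) by (simp add: c_def)
  define K where "K = k / \<omega>\<^sup>2"
  have K: "\<omega>\<^sup>2 * u x - k = \<omega> * \<omega> * (u x - K)" for x
    using assms(1) by (simp add: K_def right_diff_distrib power2_eq_square)
  define C S where "C x = cosh (\<omega> * (x - a))" and "S x = sinh (\<omega> * (x - a))" for x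
  have dC: "DERIV C x :> \<omega> * S x" and dS: "DERIV S x :> \<omega> * C x" for x
    unfolding C_def S_def by (auto intro!: derivative_eq_intros)
  have cont: "continuous_on X C" "continuous_on X S" for X
    unfolding C_def S_def by (intro continuous_intros)+
  have CS: "(C x)\<^sup>2 - (S x)\<^sup>2 = 1" for x unfolding C_def S_def by (simp add: cosh_square_eq)
  have a: "C a = 1" "S a = 0" by (auto simp: C_def S_def)
  define P where "P x = (u x - K) * C x - c * u' x * S x" for x
  define Q where "Q x = u' x * C x - \<omega> * (u x - K) * S x" for x
  let ?U = "\<lambda>x. (u a - k / \<omega>\<^sup>2) * cosh (\<omega> * (x - a)) + u' a / \<omega> * sinh (\<omega> * (x - a)) + k / \<omega>\<^sup>2"
  have eq: "u x = ?U x" if x: "a \<le> x" "x < b" for x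
  proof (cases "x = a")
    case False
    have ax: "a < x" using False x by simp
    have cx: "continuous_on {a..x} u" "continuous_on {a..x} u'"
      using x by (auto intro: continuous_on_subset[OF cu] continuous_on_subset[OF cu'])
    have "P x = P a"
    proof (rule DERIV_isconst2[OF ax])
      show "continuous_on {a..x} P" unfolding P_def by (intro continuous_intros cx cont)
      show "DERIV P y :> 0" if "a < y" "y < x" for y
      proof -
        have y: "DERIV u y :> u' y" "DERIV u' y :> \<omega> * \<omega> * (u y - K)"
          using du[of y] du'[of y] that x unfolding K by auto
        have "DERIV P y :> (u' y - 0) * C y + \<omega> * S y * (u y - K)
            - (c * (\<omega> * \<omega> * (u y - K)) * S y + \<omega> * C y * (c * u' y))"
          unfolding P_def by (intro DERIV_diff DERIV_mult DERIV_cmult DERIV_const y dC dS)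
        moreover have "(u' y - 0) * C y + \<omega> * S y * v
            - (c * (\<omega> * \<omega> * v) * S y + \<omega> * C y * (c * u' y)) =
            (1 - c * \<omega>) * (u' y * C y + v * \<omega> * S y)" for v
          by (simp add: algebra_simps)
        ultimately show ?thesis using c by simp
      qed
    qed (use ax in auto)
    moreover have "Q x = Q a"
    proof (rule DERIV_isconst2[OF ax])
      show "continuous_on {a..x} Q" unfolding Q_def by (intro continuous_intros cx cont)
      show "DERIV Q y :> 0" if "a < y" "y < x" for y
      proof -
        have y: "DERIV u y :> u' y" "DERIV u' y :> \<omega> * \<omega> * (u y - K)"
          using du[of y] du'[of y] that x unfolding K by auto
        have "DERIV Q y :> \<omega> * \<omega> * (u y - K) * C y + \<omega> * S y * u' y
            - (\<omega> * (u' y - 0) * S y + \<omega> * C y * (\<omega> * (u y - K)))"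
          unfolding Q_def by (intro DERIV_diff DERIV_mult DERIV_cmult DERIV_const y dC dS)
        then show ?thesis by (simp add: algebra_simps)
      qed
    qed (use ax in auto)
    ultimately have pq: "P x = u a - K" "Q x = u' a" by (simp_all add: P_def Q_def a)
    \<comment> \<open>Adding \<open>C\<close> times \<open>P\<close> and \<open>c * S\<close> times
      \<open>Q\<close> eliminates \<open>u'\<close>; the factor left at \<open>v\<close> is 1 by the
      hyperbolic Pythagorean identity.\<close>
    have "(v * p - c * q * s) * p + (q * p - \<omega> * v * s) * c * s = v * (p\<^sup>2 - c * \<omega> * s\<^sup>2)" for v p q s
      by (simp add: algebra_simps power2_eq_square)
    then have "P x * C x + Q x * c * S x = (u x - K) * ((C x)\<^sup>2 - c * \<omega> * (S x)\<^sup>2)"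
      unfolding P_def Q_def .
    then have "P x * C x + Q x * c * S x = u x - K" using c CS by simp
    then have "u x = (u a - K) * C x + u' a * c * S x + K" unfolding pq by linarith
    then show ?thesis unfolding C_def S_def K_def c_def times_divide_eq_right mult_1_right .
  qed simp
  \<comment> \<open>\<open>u'\<close> is not controlled at \<open>b\<close>, so the formula obtained
    on \<open>{a..<b}\<close> reaches the right endpoint through continuity of \<open>u\<close>
    alone.\<close>
  have "u x - ?U x = 0"
  proof (rule continuous_constant_on_closure[of "{a..<b}" "\<lambda>x. u x - ?U x"])
    show "continuous_on (closure {a..<b}) (\<lambda>x. u x - ?U x)"
      using assms(2) by (auto intro!: continuous_intros cu simp: assms(1))
    show "x \<in> closure {a..<b}" using assms(2) x by simp
    show "u y - ?U y = 0" if "y \<in> {a..<b}" for y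
      using eq[of y] that unfolding atLeastLessThan_iff by linarith
  qed
  then show ?thesis by linarith
qed

text \<open>Stated through a decreasing \<open>u'\<close> instead of a negative \<open>u''\<close>,
  because the second derivative of a profile jumps at its free boundary. The mean value theorem
  compares the chord slopes on either side of the intermediate point.\<close>

lemma strict_concave_on_if_deriv_decreasing:
  fixes u u' :: "real \<Rightarrow> real"
  assumes cu: "continuous_on {a..b} u"
    and du: "\<And>x. a < x \<Longrightarrow> x < b \<Longrightarrow> DERIV u x :> u' x"
    and dec: "\<And>x y. a < x \<Longrightarrow> x < y \<Longrightarrow> y < b \<Longrightarrow> u' y < u' x"
  shows "strict_concave_on {a..b} u"
proof -
  have *: "(1 - t) * u x + t * u y < u ((1 - t) * x + t * y)"
    if xy: "a \<le> x" "y \<le> b" "x < y" and t: "0 < t" "t < 1" for x y t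
  proof -
    define z where "z = (1 - t) * x + t * y"
    have z: "z - x = t * (y - x)" "y - z = (1 - t) * (y - x)" by (auto simp: z_def algebra_simps)
    have xz: "x < z" "z < y" using t xy z by (smt (verit) mult_pos_pos)+
    have mvt: "\<exists>l c. p < c \<and> c < q \<and> DERIV u c :> l \<and> u q - u p = (q - p) * l"
      if "a \<le> p" "p < q" "q \<le> b" for p q
      using that by (intro MVT) (auto intro!: continuous_on_subset[OF cu] real_differentiable_def[THEN iffD2] exI du)
    obtain p l where p: "x < p" "p < z" "DERIV u p :> l" "u z - u x = (z - x) * l"
      using mvt[of x z] xz xy by auto
    obtain q m where q: "z < q" "q < y" "DERIV u q :> m" "u y - u z = (y - z) * m"
      using mvt[of z y] xz xy by auto
    have "l = u' p" "m = u' q" using p q xy xz du[of p] du[of q] DERIV_unique by (auto; force)+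
    then have "m < l" using dec[of p q] p q xz xy by auto
    moreover have "0 < t * (1 - t) * (y - x)" using t xy by simp
    ultimately have "t * (1 - t) * (y - x) * m < t * (1 - t) * (y - x) * l"
      by (rule mult_strict_left_mono)
    moreover have "t * (u y - u z) = t * (1 - t) * (y - x) * m" "(1 - t) * (u z - u x) = t * (1 - t) * (y - x) * l"
      using p(4) q(4) z by simp_all
    ultimately have "t * (u y - u z) < (1 - t) * (u z - u x)" by (simp only:)
    then show ?thesis unfolding z_def[symmetric] by (simp add: algebra_simps)
  qed
  show ?thesis unfolding strict_concave_on_def
  proof (intro conjI ballI allI impI)
    fix x y t :: real
    assume "x \<in> {a..b}" "y \<in> {a..b}" "x \<noteq> y \<and> 0 < t \<and> t < 1"
    then show "(1 - t) * u x + t * u y < u ((1 - t) * x + t * y)"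
      using *[of x y t] *[of y x "1 - t"] by (cases "x < y") (auto simp: algebra_simps)
  qed simp
qed

lemma strict_concave_onD_midpoint:
  fixes h :: real
  assumes "strict_concave_on S u" "m - h \<in> S" "m + h \<in> S" "h \<noteq> 0"
  shows "u (m - h) + u (m + h) < 2 * u m"
proof -
  have "(1 - 1/2) * u (m - h) + 1/2 * u (m + h) < u ((1 - 1/2) * (m - h) + 1/2 * (m + h))"
    using assms unfolding strict_concave_on_def by (smt (verit) field_sum_of_halves zero_less_divide_1_iff)
  then show ?thesis by (simp add: field_simps)
qed

lemma monotone_sol_antimono:
  assumes "admissible u" "monotone_sol u" "0 \<le> x" "x \<le> y" "y \<le> 1"
  shows "u y \<le> u x"
proof -
  obtain u' where u': "\<And>x. x \<in> {0<..<1} \<Longrightarrow> (u has_real_derivative u' x) (at x)"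
    using C1_on_deriv_at_0[of u] assms(1) unfolding admissible_def by (elim conjE) metis
  show ?thesis
  proof (rule DERIV_nonpos_imp_decreasing_open[OF assms(4)])
    show "\<exists>d. DERIV u z :> d \<and> d \<le> 0" if "x < z" "z < y" for z
    proof -
      have z: "z \<in> {0<..<1}" using assms that by auto
      have "deriv u z = u' z" using u'[OF z] by (rule DERIV_imp_deriv)
      then have "u' z \<le> 0" using bspec[OF assms(2)[unfolded monotone_sol_def] z] by simp
      with u'[OF z] show ?thesis by (intro exI conjI)
    qed
    show "continuous_on {x..y} u"
      using assms by (auto simp: admissible_def intro: continuous_on_subset)
  qed
qed

lemma supnorm_monotone_sol:
  assumes "admissible u" "monotone_sol u"
  shows "supnorm u = u 0"
proof -
  have "(SUP x\<in>{0..1}. \<bar>u x\<bar>) = \<bar>u 0\<bar>"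
    by (intro cSup_eq_maximum)
      (use monotone_sol_antimono[OF assms, of 0] assms(1) in \<open>auto simp: admissible_def\<close>)
  then show ?thesis using assms(1) by (simp add: supnorm_def admissible_def)
qed

lemma cosh_gt_1: "x \<noteq> 0 \<Longrightarrow> 1 < cosh (x :: real)"
  using cosh_real_ge_1[of x] cosh_real_one_iff[of x] by linarith

lemma coalb_eq: "coalb f0 \<mu> v = (if v < \<mu> then f0 else 1)"
  by (simp add: coalb_def heaviside_def)

subsection \<open>The functions \<open>D\<close>, \<open>\<Lambda>\<close> and \<open>\<Gamma>\<close>\<close>

locale heaviside_problem =
  fixes \<omega> \<mu> f0 :: real
  assumes \<omega>_pos: "0 < \<omega>" and \<mu>_pos: "0 < \<mu>" and f0_pos: "0 < f0" and f0_less_1: "f0 < 1"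
begin

abbreviation r where "r \<equiv> rstar \<omega> f0"

text \<open>Solve the linear problem with right-hand side \<open>l\<close> on [0,s] and
  \<open>l * f0\<close> beyond it, under u'(0) = u(1) = 0. On [0,s] the solution is \<open>l /
  \<omega>\<^sup>2 * (1 - F s * cosh (\<omega> * x) / cosh \<omega>)\<close>, so its value at
  \<open>s\<close> is \<open>l * D s / (\<omega>\<^sup>2 * cosh \<omega>)\<close>; equating this
  with \<open>\<mu>\<close> gives \<open>\<Lambda>\<close>.\<close>

definition F where "F s = (1 - f0) * cosh (\<omega> - \<omega> * s) + f0" for s

definition D where "D s = cosh \<omega> - F s * cosh (\<omega> * s)" for s

text \<open>The double-angle form shows two facts at once: both summands decrease in
  \<open>s\<close>, and a zero is exactly the equation behind \<open>rstar\<close>.\<close>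

definition D' where "D' s = \<omega> * ((1 - f0) * sinh (\<omega> - 2 * \<omega> * s) - f0 * sinh (\<omega> * s))" for s

definition \<Lambda> where "\<Lambda> s = \<mu> * (\<omega>\<^sup>2 * cosh \<omega> / D s)" for s

definition \<Gamma> where "\<Gamma> s = gamma_fb \<omega> \<mu> (\<Lambda> s) s" for s

lemma cosh_\<omega>_gt_1: "1 < cosh \<omega>"
  using \<omega>_pos by (intro cosh_gt_1) simp

text \<open>The addition theorem for \<open>cosh \<omega>\<close> turns \<open>D\<close> into the
  denominator of \<open>lam1\<close>; the form with \<open>F\<close> is the convenient one for
  differentiation.\<close>

lemma D_eq:
  "D s = sinh (\<omega> * s) * sinh (\<omega> - \<omega> * s) - f0 * cosh (\<omega> * s) + f0 * cosh (\<omega> * s) * cosh (\<omega> - \<omega> * s)"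
proof -
  have "cosh \<omega> = cosh (\<omega> * s) * cosh (\<omega> - \<omega> * s) + sinh (\<omega> * s) * sinh (\<omega> - \<omega> * s)"
    using cosh_add[of "\<omega> * s" "\<omega> - \<omega> * s"] by simp
  then show ?thesis unfolding D_def F_def by (simp add: algebra_simps)
qed

lemma DERIV_F: "DERIV F s :> - ((1 - f0) * \<omega> * sinh (\<omega> - \<omega> * s))"
  unfolding F_def by (auto intro!: derivative_eq_intros)

lemma D'_eq: "D' s = \<omega> * ((1 - f0) * sinh (\<omega> - \<omega> * s) * cosh (\<omega> * s) - F s * sinh (\<omega> * s))"
proof -
  have "\<omega> - 2 * \<omega> * s = (\<omega> - \<omega> * s) - \<omega> * s" by simp
  then show ?thesis unfolding D'_def F_def by (simp only: sinh_diff) (simp add: algebra_simps)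
qed

lemma DERIV_D: "DERIV D s :> D' s"
proof -
  have "DERIV (\<lambda>s. cosh (\<omega> * s)) s :> \<omega> * sinh (\<omega> * s)"
    by (auto intro!: derivative_eq_intros)
  then have "DERIV D s :> 0 - (- ((1 - f0) * \<omega> * sinh (\<omega> - \<omega> * s)) * cosh (\<omega> * s) + \<omega> * sinh (\<omega> * s) * F s)"
    unfolding D_def by (intro DERIV_diff DERIV_mult DERIV_const DERIV_F)
  then show ?thesis unfolding D'_eq by (simp add: algebra_simps)
qed

lemma continuous_on_F: "continuous_on X F"
  unfolding F_def by (intro continuous_intros)

lemma continuous_on_D: "continuous_on X D"
  unfolding D_def by (intro continuous_intros continuous_on_F)

lemma r: "0 < r" "r < 1" and D'_r: "D' r = 0"
proof -
  have *: "0 < r \<and> r < 1 \<and> r = (m_fun \<omega> f0 r + 1) / 2"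
    unfolding rstar_def by (rule theI'[OF rstar_ex1]) (rule \<omega>_pos f0_pos f0_less_1)+
  then show "0 < r" "r < 1" by auto
  have "\<omega> * (2 * r - 1) = arsinh (f0 / (f0 - 1) * sinh (\<omega> * r))"
    using * \<omega>_pos unfolding m_fun_def by (simp add: field_simps)
  then have "sinh (\<omega> * (2 * r - 1)) = f0 / (f0 - 1) * sinh (\<omega> * r)"
    by simp
  moreover have "sinh (\<omega> - 2 * \<omega> * r) = - sinh (\<omega> * (2 * r - 1))"
    unfolding sinh_minus[symmetric] by (simp add: algebra_simps)
  ultimately show "D' r = 0" unfolding D'_def using f0_less_1 by (simp add: field_simps)
qed

text \<open>Strict concavity of \<open>D\<close>: its critical point \<open>r\<close> is the unique
  maximum, so \<open>\<Lambda>\<close> has a single turning point.\<close>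

lemma D'_strict_antimono: "s < t \<Longrightarrow> D' t < D' s"
proof -
  assume "s < t"
  then have "sinh (\<omega> - 2 * \<omega> * t) < sinh (\<omega> - 2 * \<omega> * s)" "sinh (\<omega> * s) < sinh (\<omega> * t)"
    using \<omega>_pos by auto
  then have "(1 - f0) * sinh (\<omega> - 2 * \<omega> * t) < (1 - f0) * sinh (\<omega> - 2 * \<omega> * s)"
    "f0 * sinh (\<omega> * s) < f0 * sinh (\<omega> * t)"
    using f0_pos f0_less_1 by auto
  then show ?thesis unfolding D'_def using \<omega>_pos by (intro mult_strict_left_mono) linarith+
qed

lemma D_less_left: assumes "s < t" "t \<le> r" shows "D s < D t"
proof (rule DERIV_pos_imp_increasing_open[OF assms(1) _ continuous_on_D])
  fix x assume "s < x" "x < t"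
  then have "0 < D' x" using D'_strict_antimono[of x r] D'_r assms by simp
  then show "\<exists>y. DERIV D x :> y \<and> 0 < y" using DERIV_D by blast
qed

lemma D_less_right: assumes "r \<le> s" "s < t" shows "D t < D s"
proof (rule DERIV_neg_imp_decreasing_open[OF assms(2) _ continuous_on_D])
  fix x assume "s < x" "x < t"
  then have "D' x < 0" using D'_strict_antimono[of r x] D'_r assms by simp
  then show "\<exists>y. DERIV D x :> y \<and> y < 0" using DERIV_D by blast
qed

lemma D_0: "D 0 = f0 * (cosh \<omega> - 1)" and D_1: "D 1 = 0"
  by (auto simp: D_def F_def algebra_simps)

lemma D_0_pos: "0 < D 0"
  using cosh_\<omega>_gt_1 f0_pos by (simp add: D_0)

lemma D_pos: "0 \<le> s \<Longrightarrow> s < 1 \<Longrightarrow> 0 < D s"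
  using D_less_left[of 0 s] D_less_right[of s 1] D_0_pos D_1 by (cases "s = 0"; cases "s \<le> r") auto

lemma D_le_r: "D s \<le> D r" and D_less_r: "s \<noteq> r \<Longrightarrow> D s < D r"
  using D_less_left[of s r] D_less_right[of r s] by (cases "s < r"; cases "s = r"; force)+

lemma F_ge_1: "1 \<le> F s"
proof -
  have "(1 - f0) * 1 \<le> (1 - f0) * cosh (\<omega> - \<omega> * s)"
    using f0_less_1 cosh_real_ge_1 by (intro mult_left_mono) auto
  then show ?thesis by (simp add: F_def)
qed

lemma D_less_cosh: "D s < cosh \<omega>"
  using F_ge_1[of s] by (simp add: D_def)

text \<open>\<open>F_ge_1\<close> keeps \<open>D\<close> below \<open>cosh \<omega>\<close>. The
  bound makes \<open>\<mu> - l / \<omega>\<^sup>2\<close> negative, the sign on which decrease and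
  concavity left of the free boundary rest.\<close>

lemma \<Lambda>_gt: assumes "0 \<le> s" "s < 1" shows "\<mu> * \<omega>\<^sup>2 < \<Lambda> s"
proof -
  have "1 < cosh \<omega> / D s" using D_pos[OF assms] D_less_cosh by simp
  then have "\<mu> * \<omega>\<^sup>2 * 1 < \<mu> * \<omega>\<^sup>2 * (cosh \<omega> / D s)"
    using \<mu>_pos \<omega>_pos by (intro mult_strict_left_mono) auto
  then show ?thesis by (simp add: \<Lambda>_def)
qed

lemma \<Lambda>_pos: "0 \<le> s \<Longrightarrow> s < 1 \<Longrightarrow> 0 < \<Lambda> s"
  using \<Lambda>_gt[of s] \<mu>_pos \<omega>_pos by (smt (verit) mult_pos_pos zero_less_power)

lemma \<Lambda>_less_iff:
  assumes "0 \<le> s" "s < 1" "0 \<le> t" "t < 1" shows "\<Lambda> s < \<Lambda> t \<longleftrightarrow> D t < D s"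
  using D_pos[of s] D_pos[of t] assms \<mu>_pos \<omega>_pos unfolding \<Lambda>_def
  by (simp add: field_simps)

lemma \<Lambda>_eq_iff:
  assumes "0 \<le> s" "s < 1" shows "l = \<Lambda> s \<longleftrightarrow> l * D s = \<mu> * \<omega>\<^sup>2 * cosh \<omega>"
  using D_pos[of s] assms unfolding \<Lambda>_def by (auto simp add: field_simps)

lemma lam1_eq: "lam1 \<omega> \<mu> f0 = \<Lambda> r" and lam2_eq: "lam2 \<omega> \<mu> f0 = \<Lambda> 0"
  by (simp_all add: lam1_def lam2_def \<Lambda>_def Let_def D_eq[of r] D_0)

text \<open>Eliminating \<open>\<lambda>\<close> cancels the factor
  \<open>cosh (\<omega> * s)\<close> and leaves a quotient whose derivative has a tractable
  sign.\<close>

lemma \<Gamma>_eq: assumes "0 \<le> s" "s < 1" shows "\<Gamma> s = \<mu> * (cosh \<omega> - F s) / D s"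
proof -
  have "\<Gamma> s = \<mu> / cosh (\<omega> * s) * (1 - cosh \<omega> / D s + cosh (\<omega> * s) * cosh \<omega> / D s)"
    unfolding \<Gamma>_def gamma_fb_def \<Lambda>_def using \<omega>_pos D_pos[OF assms]
    by (simp add: field_simps)
  also have "\<dots> = \<mu> / cosh (\<omega> * s) * ((D s - cosh \<omega> + cosh (\<omega> * s) * cosh \<omega>) / D s)"
    using D_pos[OF assms] by (simp add: field_simps)
  also have "D s - cosh \<omega> + cosh (\<omega> * s) * cosh \<omega> = cosh (\<omega> * s) * (cosh \<omega> - F s)"
    by (simp add: D_def algebra_simps)
  finally show ?thesis by simp
qed

lemma \<Gamma>_0: "\<Gamma> 0 = \<mu>"
  using \<omega>_pos by (simp add: \<Gamma>_def gamma_fb_def field_simps)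

lemma continuous_on_\<Gamma>: "X \<subseteq> {0..<1} \<Longrightarrow> continuous_on X \<Gamma>"
proof -
  assume X: "X \<subseteq> {0..<1}"
  have "continuous_on X (\<lambda>s. \<mu> * (cosh \<omega> - F s) / D s)"
    using X D_pos by (intro continuous_intros continuous_on_F continuous_on_D) force
  then show ?thesis using X \<Gamma>_eq by (subst continuous_on_cong[OF refl]) auto
qed

text \<open>With \<open>F = (1 - f0) c + f0\<close> the quantity \<open>F (W - F)\<close> is concave in \<open>f0\<close>, so the derivative
  of \<open>\<Gamma>\<close> is bounded below by interpolation between its values for \<open>f0 = 0\<close> and \<open>f0 = 1\<close>; the last
  summand is the interpolation error.\<close>

lemma \<Gamma>_deriv_numerator:
  fixes ch sh c S p W :: real
  assumes "ch\<^sup>2 - sh\<^sup>2 = 1" "c\<^sup>2 - S\<^sup>2 = 1" and W: "W = ch * c + sh * S"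
  shows "((1 - p) * c + p) * sh * (W - ((1 - p) * c + p)) - (1 - p) * S * W * (ch - 1) =
    (1 - p) * (ch - 1) * (sh + c * S) + p * sh * (W - 1) + (1 - p) * p * sh * (c - 1)\<^sup>2"
proof -
  have "sh * c * (W - c) - S * W * (ch - 1) =
      sh * ch * (c\<^sup>2 - S\<^sup>2) + c * S * (sh\<^sup>2 - ch\<^sup>2) - sh * (c\<^sup>2 - S\<^sup>2) + S * ch * c"
    unfolding W by (simp add: algebra_simps power2_eq_square)
  also have "\<dots> = (ch - 1) * (sh + c * S)"
    using assms(1,2) by (simp add: algebra_simps)
  finally have "(1 - p) * (sh * c * (W - c) - S * W * (ch - 1)) = (1 - p) * (ch - 1) * (sh + c * S)"
    by simp
  then show ?thesis by (simp add: algebra_simps power2_eq_square)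
qed

lemma \<Gamma>_less: assumes "0 \<le> s" "s < t" "t < 1" shows "\<Gamma> s < \<Gamma> t"
proof (rule DERIV_pos_imp_increasing_open[OF assms(2)])
  show "continuous_on {s..t} \<Gamma>" using assms by (intro continuous_on_\<Gamma>) auto
  fix x assume "s < x" "x < t"
  then have x: "0 < x" "x < 1" using assms by auto
  define ch sh c S where "ch = cosh (\<omega> * x)" "sh = sinh (\<omega> * x)" "c = cosh (\<omega> - \<omega> * x)" "S = sinh (\<omega> - \<omega> * x)"
  have Dx: "0 < D x" using D_pos x by simp
  have W: "cosh \<omega> = ch * c + sh * S"
    using cosh_add[of "\<omega> * x" "\<omega> - \<omega> * x"] by (simp add: ch_sh_c_S_def)
  \<comment> \<open>The numerator of the derivative of \<open>\<Gamma>\<close> up to the factor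
    \<open>\<mu> * \<omega>\<close>. The identity below splits it into three nonnegative terms, of
    which the middle one is positive.\<close>
  define N where "N = F x * sh * (cosh \<omega> - F x) - (1 - f0) * S * cosh \<omega> * (ch - 1)"
  have Fx: "F x = (1 - f0) * c + f0" by (simp add: F_def ch_sh_c_S_def)
  have "N = (1 - f0) * (ch - 1) * (sh + c * S) + f0 * sh * (cosh \<omega> - 1) + (1 - f0) * f0 * sh * (c - 1)\<^sup>2"
    unfolding N_def Fx
    by (rule \<Gamma>_deriv_numerator[OF _ _ W]) (simp_all add: ch_sh_c_S_def cosh_square_eq)
  moreover have "0 < sh" "1 < ch" "0 < S" "0 < c"
    using x \<omega>_pos by (auto simp: ch_sh_c_S_def intro!: cosh_gt_1)
  then have "0 < f0 * sh * (cosh \<omega> - 1)" "0 \<le> (1 - f0) * (ch - 1) * (sh + c * S)"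
      "0 \<le> (1 - f0) * f0 * sh * (c - 1)\<^sup>2"
    using f0_pos f0_less_1 cosh_\<omega>_gt_1 by simp_all
  ultimately have N: "0 < N" by linarith
  have D'x: "D' x = (1 - f0) * \<omega> * S * ch - F x * \<omega> * sh"
    unfolding D'_eq ch_sh_c_S_def by (simp add: algebra_simps)
  have "DERIV (\<lambda>s. \<mu> * (cosh \<omega> - F s) / D s) x :>
      (\<mu> * (0 - (- ((1 - f0) * \<omega> * S))) * D x - \<mu> * (cosh \<omega> - F x) * D' x) / (D x * D x)"
    unfolding ch_sh_c_S_def using Dx
    by (intro DERIV_divide DERIV_cmult DERIV_diff DERIV_const DERIV_F DERIV_D) auto
  moreover have "\<mu> * (0 - (- ((1 - f0) * \<omega> * S))) * D x - \<mu> * (cosh \<omega> - F x) * D' x = \<mu> * \<omega> * N"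
    unfolding D'x N_def by (simp add: D_def ch_sh_c_S_def algebra_simps)
  ultimately have "DERIV (\<lambda>s. \<mu> * (cosh \<omega> - F s) / D s) x :> \<mu> * \<omega> * N / (D x * D x)"
    by simp
  then have "DERIV \<Gamma> x :> \<mu> * \<omega> * N / (D x * D x)"
    by (rule has_field_derivative_transform_within_open[where S = "{0<..<1}"]) (use x \<Gamma>_eq in auto)
  moreover have "0 < \<mu> * \<omega> * N / (D x * D x)" using N Dx \<mu>_pos \<omega>_pos by simp
  ultimately show "\<exists>y. DERIV \<Gamma> x :> y \<and> 0 < y" by blast
qed

subsection \<open>Solutions with free boundary\<close>

definition inner where
  "inner l s x = (\<mu> - l / \<omega>\<^sup>2) / cosh (\<omega> * s) * cosh (\<omega> * x) + l / \<omega>\<^sup>2"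

definition inner' where
  "inner' l s x = \<omega> * ((\<mu> - l / \<omega>\<^sup>2) / cosh (\<omega> * s) * sinh (\<omega> * x))"

text \<open>The Cauchy problem at \<open>s\<close> with value \<open>\<mu>\<close> and the slope of
  \<open>inner\<close>; that slope divided by \<open>\<omega>\<close> is the coefficient of
  \<open>sinh\<close>. The condition at 1 is left open, so that it can be read as an equation for
  \<open>l\<close>.\<close>

definition outer where
  "outer l s x = (\<mu> - l * f0 / \<omega>\<^sup>2) * cosh (\<omega> * (x - s))
    + (\<mu> - l / \<omega>\<^sup>2) * tanh (\<omega> * s) * sinh (\<omega> * (x - s)) + l * f0 / \<omega>\<^sup>2"

definition outer' where
  "outer' l s x = \<omega> * ((\<mu> - l * f0 / \<omega>\<^sup>2) * sinh (\<omega> * (x - s))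
    + (\<mu> - l / \<omega>\<^sup>2) * tanh (\<omega> * s) * cosh (\<omega> * (x - s)))"

definition profile where
  "profile l s x = (if x \<le> s then inner l s x else outer l s x)"

definition profile' where
  "profile' l s x = (if x \<le> s then inner' l s x else outer' l s x)"

text \<open>At \<open>x = s\<close> this is merely the left-hand value; no second derivative is
  claimed there.\<close>

definition profile'' where
  "profile'' l s x = (if x \<le> s then \<omega>\<^sup>2 * inner l s x - l else \<omega>\<^sup>2 * outer l s x - l * f0)"

section \<open>Regularity of the profiles and matching at the free boundary\<close>

lemma DERIV_cosh_shift: "DERIV (\<lambda>x. cosh (\<omega> * (x - s))) x :> \<omega> * sinh (\<omega> * (x - s))"
  and DERIV_sinh_shift: "DERIV (\<lambda>x. sinh (\<omega> * (x - s))) x :> \<omega> * cosh (\<omega> * (x - s))"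
  by (auto intro!: derivative_eq_intros)

lemma DERIV_inner: "DERIV (inner l s) x :> inner' l s x"
proof -
  have "DERIV (inner l s) x :> (\<mu> - l / \<omega>\<^sup>2) / cosh (\<omega> * s) * (\<omega> * sinh (\<omega> * (x - 0))) + 0"
    unfolding inner_def using DERIV_cosh_shift[of 0]
    by (intro DERIV_add DERIV_cmult DERIV_const) simp
  then show ?thesis by (simp add: inner'_def mult_ac)
qed

lemma DERIV_inner': "DERIV (inner' l s) x :> \<omega>\<^sup>2 * inner l s x - l"
proof -
  have "DERIV (inner' l s) x :> \<omega> * ((\<mu> - l / \<omega>\<^sup>2) / cosh (\<omega> * s) * (\<omega> * cosh (\<omega> * (x - 0))))"
    unfolding inner'_def using DERIV_sinh_shift[of 0] by (intro DERIV_cmult) simp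
  moreover have "\<omega> * (p * (\<omega> * q)) = \<omega>\<^sup>2 * (p * q + l / \<omega>\<^sup>2) - l" for p q
    using \<omega>_pos by (simp add: distrib_left power2_eq_square)
  ultimately show ?thesis by (simp only: inner_def diff_zero)
qed

lemma DERIV_outer: "DERIV (outer l s) x :> outer' l s x"
proof -
  have "DERIV (outer l s) x :> (\<mu> - l * f0 / \<omega>\<^sup>2) * (\<omega> * sinh (\<omega> * (x - s)))
      + (\<mu> - l / \<omega>\<^sup>2) * tanh (\<omega> * s) * (\<omega> * cosh (\<omega> * (x - s))) + 0"
    unfolding outer_def
    by (intro DERIV_add DERIV_cmult DERIV_const DERIV_cosh_shift DERIV_sinh_shift)
  then show ?thesis by (simp add: outer'_def distrib_left mult_ac)
qed

lemma DERIV_outer': "DERIV (outer' l s) x :> \<omega>\<^sup>2 * outer l s x - l * f0"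
proof -
  have "DERIV (outer' l s) x :> \<omega> * ((\<mu> - l * f0 / \<omega>\<^sup>2) * (\<omega> * cosh (\<omega> * (x - s)))
      + (\<mu> - l / \<omega>\<^sup>2) * tanh (\<omega> * s) * (\<omega> * sinh (\<omega> * (x - s))))"
    unfolding outer'_def
    by (intro DERIV_add DERIV_cmult DERIV_cosh_shift DERIV_sinh_shift)
  moreover have "\<omega> * (p * (\<omega> * q) + p' * (\<omega> * q')) = \<omega>\<^sup>2 * (p * q + p' * q' + l * f0 / \<omega>\<^sup>2) - l * f0" for p q p' q'
    using \<omega>_pos by (simp add: distrib_left power2_eq_square)
  ultimately show ?thesis by (simp only: outer_def)
qed

lemma inner_s: "inner l s s = \<mu>" and outer_s: "outer l s s = \<mu>"
  and inner'_s: "inner' l s s = outer' l s s"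
  by (simp_all add: inner_def outer_def inner'_def outer'_def tanh_def)

lemma profile_s: "profile l s s = \<mu>"
  by (simp add: profile_def inner_s)

lemma DERIV_profile: "DERIV (profile l s) x :> profile' l s x"
  unfolding profile_def profile'_def
  by (rule DERIV_If_le) (auto simp: DERIV_inner DERIV_outer inner_s outer_s inner'_s)

lemma DERIV_profile': "x \<noteq> s \<Longrightarrow> DERIV (profile' l s) x :> profile'' l s x"
  unfolding profile'_def profile''_def
  by (rule DERIV_If_le) (auto simp: DERIV_inner' DERIV_outer')

lemma continuous_on_profile: "continuous_on X (profile l s)"
  by (rule DERIV_continuous_on[OF has_field_derivative_at_within[OF DERIV_profile]])

lemma continuous_on_profile': "continuous_on X (profile' l s)"
  unfolding profile'_def inner'_def outer'_def
  by (rule continuous_on_cases_le) (auto intro!: continuous_intros simp: tanh_def)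

lemma continuous_on_profile'': "s \<notin> X \<Longrightarrow> continuous_on X (profile'' l s)"
proof -
  assume s: "s \<notin> X"
  have "DERIV (profile'' l s) x :> (if x \<le> s then \<omega>\<^sup>2 * inner' l s x - 0 else \<omega>\<^sup>2 * outer' l s x - 0)"
    if "x \<noteq> s" for x
    unfolding profile''_def using that
    by (intro DERIV_If_le DERIV_diff DERIV_cmult DERIV_const DERIV_inner DERIV_outer) simp
  then have "isCont (profile'' l s) x" if "x \<noteq> s" for x using that DERIV_isCont by blast
  then show ?thesis using s by (metis continuous_at_imp_continuous_on)
qed

lemma deriv_profile: "deriv (profile l s) = profile' l s"
  using DERIV_profile DERIV_imp_deriv by blast

lemma profile_0: "0 \<le> s \<Longrightarrow> profile l s 0 = gamma_fb \<omega> \<mu> l s"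
  using \<omega>_pos by (simp add: profile_def inner_def gamma_fb_def field_simps)

lemma outer_1: "outer l s 1 = (\<mu> * \<omega>\<^sup>2 * cosh \<omega> - l * D s) / (\<omega>\<^sup>2 * cosh (\<omega> * s))"
proof -
  have W: "cosh \<omega> = cosh (\<omega> * s) * cosh (\<omega> * (1 - s)) + sinh (\<omega> * s) * sinh (\<omega> * (1 - s))"
    using cosh_add[of "\<omega> * s" "\<omega> * (1 - s)"] by (simp add: algebra_simps)
  have "\<omega> - \<omega> * s = \<omega> * (1 - s)" by (simp add: algebra_simps)
  then have D: "D s = sinh (\<omega> * s) * sinh (\<omega> * (1 - s)) - f0 * cosh (\<omega> * s) + f0 * cosh (\<omega> * s) * cosh (\<omega> * (1 - s))"
    using D_eq[of s] by simp
  \<comment> \<open>After both expansions the claim is a rational identity that uses no relation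
    between the hyperbolic values, hence the free variables.\<close>
  have "(\<mu> - l * f0 / w) * c + (\<mu> - l / w) * (sh / ch) * S + l * f0 / w =
     (\<mu> * w * (ch * c + sh * S) - l * (sh * S - f0 * ch + f0 * ch * c)) / (w * ch)"
    if "w \<noteq> 0" "ch \<noteq> 0" for w c sh ch S :: real
    using that by (simp add: divide_simps) (simp add: algebra_simps)
  then show ?thesis unfolding outer_def W D tanh_def using \<omega>_pos by simp
qed

lemma outer_1_eq_0_iff: "0 \<le> s \<Longrightarrow> s < 1 \<Longrightarrow> outer l s 1 = 0 \<longleftrightarrow> l = \<Lambda> s"
  using \<omega>_pos by (auto simp: outer_1 \<Lambda>_eq_iff)

text \<open>Let \<open>A\<close> and \<open>B\<close> be the coefficients of \<open>cosh\<close> and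
  \<open>sinh\<close> in \<open>outer\<close>, where \<open>B \<le> 0\<close>. For
  \<open>A < 0\<close> the sign is immediate. Otherwise the condition at 1 is needed: it says
  \<open>A * cosh Y + B * sinh Y < 0\<close>, and multiplying the slope at \<open>y\<close> by
  \<open>sinh Y\<close> reduces it to this quantity up to the term
  \<open>- A * cosh (Y - y)\<close>, which has the right sign.\<close>

lemma outer'_neg:
  assumes s: "0 \<le> s" "s < 1" and l: "l = \<Lambda> s" and x: "s < x" "x \<le> 1"
  shows "outer' l s x < 0"
proof -
  define A where "A = \<mu> - l * f0 / \<omega>\<^sup>2"
  define B where "B = (\<mu> - l / \<omega>\<^sup>2) * tanh (\<omega> * s)"
  define y Y where "y = \<omega> * (x - s)" "Y = \<omega> * (1 - s)"
  have pos: "0 < y" "0 < Y" using s x \<omega>_pos by (auto simp: y_Y_def)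
  have sh: "0 < sinh y" "0 < sinh Y" using pos by auto
  have l0: "0 < l * f0 / \<omega>\<^sup>2" using \<Lambda>_pos[OF s] l f0_pos \<omega>_pos by simp
  have "\<mu> - l / \<omega>\<^sup>2 < 0" using \<Lambda>_gt[OF s] l \<omega>_pos by (simp add: field_simps)
  then have B: "B \<le> 0" unfolding B_def using s \<omega>_pos by (intro mult_nonpos_nonneg) auto
  have bc: "A * cosh Y + B * sinh Y < 0"
    using outer_1_eq_0_iff[OF s, of l] l l0 unfolding outer_def A_def B_def y_Y_def by linarith
  have "A * sinh y + B * cosh y < 0"
  proof (cases "A < 0")
    case True
    then have "A * sinh y < 0" using sh by (simp add: mult_neg_pos)
    moreover have "B * cosh y \<le> 0" using B by (simp add: mult_nonpos_nonneg)
    ultimately show ?thesis by linarith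
  next
    case False
    have "sinh Y * (A * sinh y + B * cosh y) = cosh y * (A * cosh Y + B * sinh Y) - A * cosh (Y - y)"
      by (simp add: cosh_diff algebra_simps)
    also have "\<dots> < 0"
    proof -
      have "cosh y * (A * cosh Y + B * sinh Y) < 0" using bc by (simp add: mult_pos_neg)
      moreover have "0 \<le> A * cosh (Y - y)" using False by simp
      ultimately show ?thesis by linarith
    qed
    finally show ?thesis using sh(2) by (simp add: mult_less_0_iff)
  qed
  then show ?thesis unfolding outer'_def using \<omega>_pos
    by (simp add: A_def B_def y_Y_def mult_less_0_iff)
qed

lemma profile'_neg:
  assumes "0 \<le> s" "s < 1" "l = \<Lambda> s" "0 < x" "x \<le> 1"
  shows "profile' l s x < 0"
proof (cases "x \<le> s")
  case True
  have "(\<mu> - l / \<omega>\<^sup>2) / cosh (\<omega> * s) < 0"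
    using \<Lambda>_gt[of s] assms \<omega>_pos by (simp add: field_simps)
  then have "(\<mu> - l / \<omega>\<^sup>2) / cosh (\<omega> * s) * sinh (\<omega> * x) < 0"
    using assms \<omega>_pos by (intro mult_neg_pos) auto
  then have "inner' l s x < 0" unfolding inner'_def by (rule mult_pos_neg[OF \<omega>_pos])
  then show ?thesis using True by (simp add: profile'_def)
next
  case False
  then show ?thesis using assms outer'_neg by (simp add: profile'_def)
qed

lemma profile_less:
  assumes "0 \<le> s" "s < 1" "l = \<Lambda> s" "0 \<le> x" "x < y" "y \<le> 1"
  shows "profile l s y < profile l s x"
proof (rule DERIV_neg_imp_decreasing_open[OF assms(5) _ continuous_on_profile])
  fix z assume "x < z" "z < y"
  then have "profile' l s z < 0" using assms by (intro profile'_neg) auto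
  then show "\<exists>d. DERIV (profile l s) z :> d \<and> d < 0" using DERIV_profile by blast
qed

lemma profile_1: "0 \<le> s \<Longrightarrow> s < 1 \<Longrightarrow> l = \<Lambda> s \<Longrightarrow> profile l s 1 = 0"
  using outer_1_eq_0_iff[of s l] by (simp add: profile_def)

lemma profile'_0: "0 \<le> s \<Longrightarrow> profile' l s 0 = 0"
  by (simp add: profile'_def inner'_def)

lemma profile_monotone: "0 \<le> s \<Longrightarrow> s < 1 \<Longrightarrow> l = \<Lambda> s \<Longrightarrow> monotone_sol (profile l s)"
  using profile'_neg[of s l] by (simp add: monotone_sol_def deriv_profile less_imp_le)

lemma profile_admissible:
  assumes s: "0 \<le> s" "s < 1" and l: "l = \<Lambda> s"
  shows "admissible (profile l s)"
  unfolding admissible_def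
proof (intro conjI ballI)
  show "C1_on (profile l s) {0..<1}"
    unfolding C1_on_def
    by (intro exI[of _ "profile' l s"] conjI ballI continuous_on_profile'
        has_field_derivative_at_within[OF DERIV_profile])
  show "continuous_on {0..1} (profile l s)" by (rule continuous_on_profile)
  show "0 \<le> profile l s x" if "x \<in> {0..1}" for x
    using profile_less[OF s l, of x 1] profile_1[OF s l] that by (cases "x = 1") auto
  show "\<exists>x\<in>{0..1}. profile l s x \<noteq> 0"
    using s \<mu>_pos profile_s[of l s] by (intro bexI[of _ s]) auto
  show "(profile l s has_real_derivative 0) (at 0 within {0..<1})"
    using DERIV_profile[of l s 0] profile'_0[OF s(1)] by (simp add: has_field_derivative_at_within)
  show "profile l s 1 = 0" by (rule profile_1[OF s l])
qed

lemma profile_fb_solution: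
  assumes s: "0 \<le> s" "s < 1" and l: "l = \<Lambda> s"
  shows "fb_solution \<omega> \<mu> f0 l (profile l s) s"
  unfolding fb_solution_def
proof (intro conjI)
  show "C2_on (profile l s) ({0<..<1} - {s})"
    unfolding C2_on_def
  proof (intro exI[of _ "profile' l s"] conjI ballI)
    show "(profile l s has_real_derivative profile' l s x) (at x within {0<..<1} - {s})" for x
      by (rule has_field_derivative_at_within[OF DERIV_profile])
    show "C1_on (profile' l s) ({0<..<1} - {s})"
      unfolding C1_on_def
      by (intro exI[of _ "profile'' l s"] conjI ballI continuous_on_profile''
          has_field_derivative_at_within[OF DERIV_profile']) auto
  qed
  show "satisfies_ode_on \<omega> \<mu> f0 l ({0<..<1} - {s}) (profile l s)"
    unfolding satisfies_ode_on_def
  proof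
    fix x assume x: "x \<in> {0<..<1} - {s}"
    have "deriv (deriv (profile l s)) x = profile'' l s x"
      unfolding deriv_profile using x by (intro DERIV_imp_deriv DERIV_profile') simp
    \<comment> \<open>Strict decrease makes the value selected by \<open>coalb\<close> agree with
      the side of \<open>s\<close> on which \<open>x\<close> lies, that is, with the case
      distinction in \<open>profile''\<close>.\<close>
    moreover have "profile l s x < \<mu> \<longleftrightarrow> s < x"
      using profile_less[OF s l, of s x] profile_less[OF s l, of x s] profile_s[of l s] x s by force
    ultimately show "- deriv (deriv (profile l s)) x + \<omega>\<^sup>2 * profile l s x = l * coalb f0 \<mu> (profile l s x)"
      unfolding coalb_eq by (simp add: profile''_def profile_def)
  qed
qed (use s profile_s profile_admissible[OF s l] in auto)

lemma supnorm_profile: "0 \<le> s \<Longrightarrow> s < 1 \<Longrightarrow> l = \<Lambda> s \<Longrightarrow> supnorm (profile l s) = profile l s 0"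
  by (intro supnorm_monotone_sol profile_admissible profile_monotone)

section \<open>Strict concavity of the profiles\<close>

lemma strict_concave_profile_inner:
  assumes s: "0 \<le> s" "s < 1" and l: "l = \<Lambda> s"
  shows "strict_concave_on {0..s} (profile l s)"
proof (rule strict_concave_on_if_deriv_decreasing[OF continuous_on_profile DERIV_profile])
  fix x y assume "0 < x" "x < y" "y < s"
  moreover have "(\<mu> - l / \<omega>\<^sup>2) / cosh (\<omega> * s) < 0"
    using \<Lambda>_gt[OF s] l \<omega>_pos by (simp add: field_simps)
  ultimately have "(\<mu> - l / \<omega>\<^sup>2) / cosh (\<omega> * s) * sinh (\<omega> * y) < (\<mu> - l / \<omega>\<^sup>2) / cosh (\<omega> * s) * sinh (\<omega> * x)"
    using \<omega>_pos by (intro mult_strict_left_mono_neg) auto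
  then have "inner' l s y < inner' l s x"
    unfolding inner'_def using \<omega>_pos by (rule mult_strict_left_mono)
  then show "profile' l s y < profile' l s x"
    using \<open>x < y\<close> \<open>y < s\<close> by (simp add: profile'_def)
qed

text \<open>Right of \<open>s\<close> the equation reads
  \<open>u'' = \<omega>\<^sup>2 * u - l * f0\<close> with \<open>u < \<mu>\<close>, so
  \<open>le\<close> gives \<open>u'' < 0\<close>; left of \<open>s\<close> the negative coefficient
  of \<open>cosh\<close> does.\<close>

lemma strict_concave_profile:
  assumes s: "0 \<le> s" "s < 1" and l: "l = \<Lambda> s" and le: "\<mu> * \<omega>\<^sup>2 \<le> l * f0"
  shows "strict_concave_on {0..1} (profile l s)"
proof (rule strict_concave_on_if_deriv_decreasing[OF continuous_on_profile DERIV_profile])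
  have neg: "profile'' l s z < 0" if "0 < z" "z < 1" "z \<noteq> s" for z
  proof (cases "z \<le> s")
    case True
    have "(\<mu> - l / \<omega>\<^sup>2) / cosh (\<omega> * s) < 0"
      using \<Lambda>_gt[OF s] l \<omega>_pos by (simp add: field_simps)
    then have "\<omega>\<^sup>2 * ((\<mu> - l / \<omega>\<^sup>2) / cosh (\<omega> * s) * cosh (\<omega> * z)) < 0"
      using \<omega>_pos by (intro mult_pos_neg mult_neg_pos) auto
    then show ?thesis using True \<omega>_pos by (simp add: profile''_def inner_def distrib_left)
  next
    case False
    then have "profile l s z < \<mu>"
      using profile_less[OF s l, of s z] s that profile_s[of l s] by simp
    then have "\<omega>\<^sup>2 * outer l s z < \<omega>\<^sup>2 * \<mu>"
      using False \<omega>_pos by (intro mult_strict_left_mono) (auto simp: profile_def)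
    also have "\<dots> \<le> l * f0" using le by (simp add: mult.commute)
    finally show ?thesis using False by (simp add: profile''_def)
  qed
  have dec: "profile' l s y < profile' l s x" if "0 \<le> x" "x < y" "y < 1" "s \<le> x \<or> y \<le> s" for x y
  proof (rule DERIV_neg_imp_decreasing_open[OF that(2) _ continuous_on_profile'])
    fix z assume "x < z" "z < y"
    then have "z \<noteq> s" "0 < z" "z < 1" using that by auto
    then show "\<exists>d. DERIV (profile' l s) z :> d \<and> d < 0" using neg DERIV_profile' by blast
  qed
  \<comment> \<open>An interval with \<open>s\<close> inside is cut at \<open>s\<close>, where
    \<open>u'\<close> is continuous but \<open>u''\<close> jumps.\<close>
  show "profile' l s y < profile' l s x" if "0 < x" "x < y" "y < 1" for x y
    using dec[of x y] dec[of x s] dec[of s y] that by (cases "s \<le> x \<or> y \<le> s") auto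
qed

text \<open>If \<open>\<mu> \<omega>\<^sup>2 > l f0\<close>, then \<open>u''\<close> is positive just to the right of the free boundary.\<close>

lemma strict_concave_profileD:
  assumes s: "0 \<le> s" "s < 1" and l: "l = \<Lambda> s" and sc: "strict_concave_on {0..1} (profile l s)"
  shows "\<mu> * \<omega>\<^sup>2 \<le> l * f0"
proof (rule ccontr)
  assume "\<not> ?thesis"
  then have "l * f0 / \<omega>\<^sup>2 < \<mu>" using \<omega>_pos by (simp add: field_simps)
  moreover have "isCont (outer l s) s" using DERIV_outer DERIV_isCont by blast
  ultimately have "eventually (\<lambda>x. l * f0 / \<omega>\<^sup>2 < outer l s x) (at s)"
    unfolding isCont_def outer_s by (intro order_tendstoD)
  then have "eventually (\<lambda>x. l * f0 / \<omega>\<^sup>2 < outer l s x) (at_right s)"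
    by (simp add: eventually_at_split)
  \<comment> \<open>The bound \<open>(1 + s) / 2\<close> keeps the reflected point
    \<open>2 * x - s\<close> below 1.\<close>
  moreover have "eventually (\<lambda>x. x \<in> {s<..<(1 + s) / 2}) (at_right s)"
    using s by (intro eventually_at_right_real) simp
  ultimately have "eventually (\<lambda>x. l * f0 / \<omega>\<^sup>2 < outer l s x \<and> x \<in> {s<..<(1 + s) / 2}) (at_right s)"
    by (rule eventually_conj)
  then obtain x where x: "l * f0 / \<omega>\<^sup>2 < outer l s x" "s < x" "x < (1 + s) / 2"
    using eventually_happens'[OF trivial_limit_at_right_real] by fastforce
  define h where "h = x - s"
  have h: "0 < h" "x = s + h" using x by (auto simp: h_def)
  have "profile l s (x - h) + profile l s (x + h) < 2 * profile l s x"
    using sc by (rule strict_concave_onD_midpoint) (use x s h in \<open>auto simp: field_simps\<close>)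
  then have "outer l s s + outer l s (x + h) < 2 * outer l s x"
    using h by (simp add: profile_def inner_s outer_s)
  \<comment> \<open>\<open>outer\<close> minus \<open>l * f0 / \<omega>\<^sup>2\<close> solves
    \<open>v'' = \<omega>\<^sup>2 * v\<close>, and such \<open>v\<close> satisfy
    \<open>v (x - h) + v (x + h) = 2 * cosh (\<omega> * h) * v x\<close>. A positive
    \<open>v x\<close> therefore violates midpoint concavity.\<close>
  moreover have "outer l s s + outer l s (x + h) - 2 * (l * f0 / \<omega>\<^sup>2) =
      2 * cosh (\<omega> * h) * (outer l s x - l * f0 / \<omega>\<^sup>2)"
  proof -
    have "\<omega> * (x + h - s) = \<omega> * h + \<omega> * h" "\<omega> * (x - s) = \<omega> * h" "\<omega> * (s - s) = 0"
      using h by (auto simp: algebra_simps)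
    moreover have "sinh (\<omega> * h) * sinh (\<omega> * h) = cosh (\<omega> * h) * cosh (\<omega> * h) - 1"
      using cosh_square_eq[of "\<omega> * h"] by (simp add: power2_eq_square)
    ultimately show ?thesis
      unfolding outer_def by (simp only: cosh_add sinh_add) (simp add: algebra_simps)
  qed
  moreover have "1 * (outer l s x - l * f0 / \<omega>\<^sup>2) \<le> cosh (\<omega> * h) * (outer l s x - l * f0 / \<omega>\<^sup>2)"
    using x cosh_real_ge_1 by (intro mult_right_mono) auto
  ultimately show False by simp
qed

subsection \<open>Solutions without free boundary\<close>

text \<open>The first integrals need the derivative of a \<open>u'\<close> that is continuous up to
  0, whereas the equation fixes \<open>deriv (deriv u)\<close>; \<open>deriv u\<close> and
  \<open>u'\<close> agree on the open set \<open>S\<close>.\<close>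

lemma second_order_ode:
  assumes "open S" "S \<subseteq> {0<..<1}" "C2_on u S" "satisfies_ode_on \<omega> \<mu> f0 l S u"
    and u': "\<And>x. x \<in> {0<..<1} \<Longrightarrow> DERIV u x :> u' x" and x: "x \<in> S"
  shows "DERIV u' x :> \<omega>\<^sup>2 * u x - l * coalb f0 \<mu> (u x)"
    and "deriv (deriv u) x = \<omega>\<^sup>2 * u x - l * coalb f0 \<mu> (u x)"
proof -
  show eq: "deriv (deriv u) x = \<omega>\<^sup>2 * u x - l * coalb f0 \<mu> (u x)"
    using assms(4) x unfolding satisfies_ode_on_def by (smt (verit, best))
  have "DERIV (deriv u) x :> \<omega>\<^sup>2 * u x - l * coalb f0 \<mu> (u x)"
    using C2_on_openD(1)[OF assms(1,3) x] unfolding eq .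
  then show "DERIV u' x :> \<omega>\<^sup>2 * u x - l * coalb f0 \<mu> (u x)"
  proof (rule has_field_derivative_transform_within_open[OF _ assms(1) x])
    show "deriv u y = u' y" if "y \<in> S" for y
      using u'[of y] assms(2) that by (intro DERIV_imp_deriv) auto
  qed
qed

definition cold where "cold l x = l * f0 / \<omega>\<^sup>2 - l * f0 / (\<omega>\<^sup>2 * cosh \<omega>) * cosh (\<omega> * x)"

definition cold' where "cold' l x = - (l * f0 / (\<omega>\<^sup>2 * cosh \<omega>) * (\<omega> * sinh (\<omega> * x)))"

lemma DERIV_cold: "DERIV (cold l) x :> cold' l x"
proof -
  have "DERIV (cold l) x :> 0 - l * f0 / (\<omega>\<^sup>2 * cosh \<omega>) * (\<omega> * sinh (\<omega> * (x - 0)))"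
    unfolding cold_def using DERIV_cosh_shift[of 0]
    by (intro DERIV_diff DERIV_cmult DERIV_const) simp
  then show ?thesis by (simp add: cold'_def)
qed

lemma DERIV_cold': "DERIV (cold' l) x :> \<omega>\<^sup>2 * cold l x - l * f0"
proof -
  have "DERIV (cold' l) x :> - (l * f0 / (\<omega>\<^sup>2 * cosh \<omega>) * (\<omega> * (\<omega> * cosh (\<omega> * (x - 0)))))"
    unfolding cold'_def using DERIV_sinh_shift[of 0] by (intro DERIV_minus DERIV_cmult) simp
  moreover have "- (p * (\<omega> * (\<omega> * q))) = \<omega>\<^sup>2 * (l * f0 / \<omega>\<^sup>2 - p * q) - l * f0" for p q
    using \<omega>_pos by (simp add: right_diff_distrib power2_eq_square)
  ultimately show ?thesis by (simp only: cold_def diff_zero)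
qed

lemma cold_0: "cold l 0 = gamma_star \<omega> f0 l"
  using \<omega>_pos by (simp add: cold_def gamma_star_def field_simps)

text \<open>Proportionality to \<open>l\<close> with value \<open>\<mu>\<close> at
  \<open>\<Lambda> 0\<close>: the line ends exactly where the free boundary branch starts, at
  \<open>s = 0\<close>.\<close>

lemma gamma_star_eq: "gamma_star \<omega> f0 l = l / \<Lambda> 0 * \<mu>"
  using \<mu>_pos \<omega>_pos by (simp add: gamma_star_def \<Lambda>_def D_0)

lemma \<Lambda>_0_pos: "0 < \<Lambda> 0"
  by (rule \<Lambda>_pos) simp_all

lemma gamma_star_less_iff: "gamma_star \<omega> f0 l < \<mu> \<longleftrightarrow> l < \<Lambda> 0"
  using \<Lambda>_0_pos \<mu>_pos by (simp add: gamma_star_eq field_simps)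

lemma gamma_star_mono: "l < l' \<Longrightarrow> gamma_star \<omega> f0 l < gamma_star \<omega> f0 l'"
  using \<Lambda>_0_pos \<mu>_pos by (simp add: gamma_star_eq field_simps)

lemma cold_le: "0 \<le> l \<Longrightarrow> cold l x \<le> cold l 0"
proof -
  assume "0 \<le> l"
  then have "l * f0 / (\<omega>\<^sup>2 * cosh \<omega>) * 1 \<le> l * f0 / (\<omega>\<^sup>2 * cosh \<omega>) * cosh (\<omega> * x)"
    using f0_pos cosh_real_ge_1 by (intro mult_left_mono) auto
  then show ?thesis by (simp add: cold_def)
qed

lemma cold_1: "cold l 1 = 0"
  by (simp add: cold_def)

lemma cold_nonneg: assumes "0 \<le> l" "x \<in> {0..1}" shows "0 \<le> cold l x"
proof -
  have "\<omega> * x \<le> \<omega>" using assms(2) \<omega>_pos by (simp add: mult_left_le)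
  then have "cosh (\<omega> * x) \<le> cosh (\<omega> * 1)"
    using assms(2) \<omega>_pos by (simp add: cosh_real_nonneg_le_iff)
  then have "l * f0 / (\<omega>\<^sup>2 * cosh \<omega>) * cosh (\<omega> * x) \<le> l * f0 / (\<omega>\<^sup>2 * cosh \<omega>) * cosh (\<omega> * 1)"
    using f0_pos assms(1) by (intro mult_left_mono) auto
  then show ?thesis using cold_1[of l] by (simp only: cold_def)
qed

lemma cold_monotone: "0 \<le> l \<Longrightarrow> monotone_sol (cold l)"
  using \<omega>_pos f0_pos DERIV_imp_deriv[OF DERIV_cold] by (simp add: monotone_sol_def cold'_def)

lemma cold_admissible:
  assumes l: "0 < l"
  shows "admissible (cold l)"
  unfolding admissible_def
proof (intro conjI ballI)
  have "continuous_on {0..<1} (cold' l)" unfolding cold'_def by (intro continuous_intros)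
  then show "C1_on (cold l) {0..<1}"
    unfolding C1_on_def using has_field_derivative_at_within[OF DERIV_cold] by blast
  show "continuous_on {0..1} (cold l)"
    by (rule DERIV_continuous_on[OF has_field_derivative_at_within[OF DERIV_cold]])
  show "0 \<le> cold l x" if "x \<in> {0..1}" for x using cold_nonneg l that by simp
  have "0 < gamma_star \<omega> f0 l" using l \<mu>_pos \<Lambda>_0_pos by (simp add: gamma_star_eq)
  then show "\<exists>x\<in>{0..1}. cold l x \<noteq> 0" using cold_0[of l] by (intro bexI[of _ 0]) auto
  show "(cold l has_real_derivative 0) (at 0 within {0..<1})"
    using has_field_derivative_at_within[OF DERIV_cold, of l 0] by (simp add: cold'_def)
qed (rule cold_1)

lemma cold_nofb_solution:
  assumes l: "0 < l" "l < \<Lambda> 0"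
  shows "nofb_solution \<omega> \<mu> f0 l (cold l)"
proof -
  have less: "cold l x < \<mu>" for x
    using cold_le[of l x] gamma_star_less_iff[of l] cold_0[of l] l by simp
  have dd: "deriv (cold l) = cold' l" "deriv (cold' l) = (\<lambda>x. \<omega>\<^sup>2 * cold l x - l * f0)"
    using DERIV_imp_deriv[OF DERIV_cold] DERIV_imp_deriv[OF DERIV_cold'] by blast+
  have cc: "continuous_on X (\<lambda>x. \<omega>\<^sup>2 * cold l x - l * f0)" for X
    unfolding cold_def by (intro continuous_intros)
  have "C1_on (cold' l) {0<..<1}"
    unfolding C1_on_def
    by (intro exI[of _ "\<lambda>x. \<omega>\<^sup>2 * cold l x - l * f0"] conjI ballI cc has_field_derivative_at_within[OF DERIV_cold'])
  then have "C2_on (cold l) {0<..<1}"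
    unfolding C2_on_def
    by (intro exI[of _ "cold' l"] conjI ballI has_field_derivative_at_within[OF DERIV_cold])
  then show ?thesis
    using cold_admissible[OF l(1)] less
    by (simp add: nofb_solution_def satisfies_ode_on_def dd coalb_eq)
qed

section \<open>Uniqueness of solutions\<close>

lemma nofb_solution_unique:
  assumes l: "0 < l" and v: "nofb_solution \<omega> \<mu> f0 l v"
  shows "\<And>x. x \<in> {0..1} \<Longrightarrow> v x = cold l x" and "l < \<Lambda> 0"
proof -
  have adm: "admissible v" and C2: "C2_on v {0<..<1}" and ode: "satisfies_ode_on \<omega> \<mu> f0 l {0<..<1} v"
    and coalb: "\<And>x. x \<in> {0..1} \<Longrightarrow> coalb f0 \<mu> (v x) = f0"
    using v by (auto simp: nofb_solution_def)
  have v1: "v 1 = 0" and cv: "continuous_on {0..1} v" using adm by (auto simp: admissible_def)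
  have "C1_on v {0..<1}" "(v has_real_derivative 0) (at 0 within {0..<1})"
    using adm by (auto simp: admissible_def)
  then obtain u' where u': "\<And>x. x \<in> {0<..<1} \<Longrightarrow> DERIV v x :> u' x"
    "continuous_on {0..<1} u'" "u' 0 = 0"
    using C1_on_deriv_at_0 by metis
  \<comment> \<open>Since \<open>coalb\<close> is constantly \<open>f0\<close> along
    \<open>v\<close>, the equation is linear on the whole interval; the only free constant is
    \<open>v 0\<close>, and the condition at 1 determines it.\<close>
  have eq: "v x = (v 0 - l * f0 / \<omega>\<^sup>2) * cosh (\<omega> * (x - 0)) + u' 0 / \<omega> * sinh (\<omega> * (x - 0)) + l * f0 / \<omega>\<^sup>2"
    if "x \<in> {0..1}" for x
  proof (rule linear_ode_solution[OF _ _ cv u'(2) _ _ that])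
    fix x :: real assume x: "0 < x" "x < 1"
    then show "DERIV v x :> u' x" using u'(1) by simp
    show "DERIV u' x :> \<omega>\<^sup>2 * v x - l * f0"
      using second_order_ode(1)[OF _ _ C2 ode u'(1), of x] coalb[of x] x by simp
  qed (use \<omega>_pos in auto)
  have v0: "v 0 - l * f0 / \<omega>\<^sup>2 = - (l * f0 / (\<omega>\<^sup>2 * cosh \<omega>))"
  proof -
    have "(v 0 - l * f0 / \<omega>\<^sup>2) * cosh \<omega> = - (l * f0 / \<omega>\<^sup>2)"
      using eq[of 1] v1 u'(3) by simp
    then have "v 0 - l * f0 / \<omega>\<^sup>2 = - (l * f0 / \<omega>\<^sup>2) / cosh \<omega>"
      by (intro nonzero_eq_divide_eq[THEN iffD2]) simp_all
    then show ?thesis by simp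
  qed
  show *: "v x = cold l x" if "x \<in> {0..1}" for x
    using eq[OF that] u'(3) unfolding v0 cold_def by simp
  \<comment> \<open>\<open>coalb\<close> is 1 from the level \<open>\<mu>\<close> on, so the value
    \<open>f0 < 1\<close> forces \<open>v 0 < \<mu>\<close>; this is what ends the line at
    \<open>\<Lambda> 0\<close>.\<close>
  have "v 0 < \<mu>" using coalb[of 0] f0_less_1 by (simp add: coalb_eq split: if_splits)
  then show "l < \<Lambda> 0" using *[of 0] cold_0 gamma_star_less_iff by simp
qed

text \<open>Past the free boundary \<open>u\<close> cannot stay equal to \<open>\<mu>\<close>: at the last such point \<open>t\<close> the
  continuous function \<open>u''\<close> would jump by \<open>l (1 - f0)\<close>.\<close>

lemma fb_solution_less:
  assumes l: "0 < l" and v: "fb_solution \<omega> \<mu> f0 l v s" and mono: "monotone_sol v"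
    and x: "s < x" "x \<le> 1"
  shows "v x < \<mu>"
proof (rule ccontr)
  assume "\<not> v x < \<mu>"
  have s: "0 \<le> s" "s < 1" "v s = \<mu>" and adm: "admissible v" and C2: "C2_on v ({0<..<1} - {s})"
    and ode: "satisfies_ode_on \<omega> \<mu> f0 l ({0<..<1} - {s}) v"
    using v by (auto simp: fb_solution_def)
  have v1: "v 1 = 0" and cv: "continuous_on {0..1} v" using adm by (auto simp: admissible_def)
  have cv': "continuous_on {x..1} v" using x s by (intro continuous_on_subset[OF cv]) auto
  have vx: "v x = \<mu>" using monotone_sol_antimono[OF adm mono, of s x] s x \<open>\<not> v x < \<mu>\<close> by simp
  define T where "T = {y \<in> {x..1}. v y = \<mu>}"
  have "closed T" unfolding T_def by (rule continuous_closed_preimage_constant[OF cv']) simp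
  moreover have "bounded T" by (rule bounded_subset[of "{x..1}"]) (auto simp: T_def)
  moreover have "T \<noteq> {}" using vx x by (auto simp: T_def)
  ultimately obtain t where t: "t \<in> T" "\<And>y. y \<in> T \<Longrightarrow> y \<le> t"
    using compact_attains_sup[of T] compact_eq_bounded_closed by blast
  have t1: "t < 1" using t(1) v1 \<mu>_pos by (cases "t = 1") (auto simp: T_def)
  have ts: "s < t" "x \<le> t" "v t = \<mu>" using t(1) x by (auto simp: T_def)
  have less: "v y < \<mu>" if "t < y" "y < 1" for y
    using monotone_sol_antimono[OF adm mono, of t y] t(2)[of y] that ts s
    by (force simp: T_def)
  let ?S = "{0<..<1} - {s}"
  have S: "open ?S" by (simp add: open_Diff)
  have tS: "t \<in> ?S" using ts t1 s by auto
  obtain u' where u': "\<And>x. x \<in> {0<..<1} \<Longrightarrow> DERIV v x :> u' x"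
    using C1_on_deriv_at_0[of v] adm unfolding admissible_def by (elim conjE) metis
  have dd: "deriv (deriv v) y = \<omega>\<^sup>2 * v y - l * coalb f0 \<mu> (v y)" if "y \<in> ?S" for y
    using second_order_ode(2)[OF S _ C2 ode u' that] by auto
  have "isCont (deriv (deriv v)) t"
    using C2_on_openD(2)[OF S C2] tS S continuous_on_eq_continuous_at by blast
  then have "(deriv (deriv v) \<longlongrightarrow> deriv (deriv v) t) (at_right t)"
    unfolding isCont_def filterlim_at_split by blast
  \<comment> \<open>On the level \<open>\<mu>\<close> itself the nonlinearity is 1, because
    \<open>heaviside 0 = 1\<close>, while just right of \<open>t\<close> it is \<open>f0\<close>.
    The two limits of \<open>u''\<close> computed below differ for this reason.\<close>
  then have lim: "(deriv (deriv v) \<longlongrightarrow> \<omega>\<^sup>2 * \<mu> - l) (at_right t)"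
    using dd[OF tS] ts by (simp add: coalb_eq)
  have "eventually (\<lambda>y. y \<in> {t<..<1}) (at_right t)"
    using t1 by (rule eventually_at_right_real)
  then have "eventually (\<lambda>y. deriv (deriv v) y = \<omega>\<^sup>2 * v y - l * f0) (at_right t)"
    by (rule eventually_mono) (use dd less ts s in \<open>auto simp: coalb_eq\<close>)
  then have 1: "((\<lambda>y. \<omega>\<^sup>2 * v y - l * f0) \<longlongrightarrow> \<omega>\<^sup>2 * \<mu> - l) (at_right t)"
    by (rule Lim_transform_eventually[OF lim])
  have "isCont v t" using u'[of t] tS DERIV_isCont by blast
  then have "(v \<longlongrightarrow> \<mu>) (at_right t)"
    unfolding isCont_def filterlim_at_split by (simp add: ts)
  then have 2: "((\<lambda>y. \<omega>\<^sup>2 * v y - l * f0) \<longlongrightarrow> \<omega>\<^sup>2 * \<mu> - l * f0) (at_right t)"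
    by (intro tendsto_intros)
  have "\<omega>\<^sup>2 * \<mu> - l = \<omega>\<^sup>2 * \<mu> - l * f0"
    by (rule tendsto_unique[OF trivial_limit_at_right_real 1 2])
  then show False using l f0_less_1 by simp
qed

text \<open>Monotonicity gives \<open>v \<ge> \<mu>\<close> before \<open>s\<close> and
  \<open>fb_solution_less\<close> gives \<open>v < \<mu>\<close> after it. Each side thus obeys a
  known linear equation, and the Cauchy data travel from 0 through \<open>s\<close> to 1.\<close>

lemma fb_solution_unique:
  assumes l: "0 < l" and v: "fb_solution \<omega> \<mu> f0 l v s" and mono: "monotone_sol v"
  shows "l = \<Lambda> s" and "\<And>x. x \<in> {0..1} \<Longrightarrow> v x = profile l s x"
proof -
  have s: "0 \<le> s" "s < 1" "v s = \<mu>" and adm: "admissible v" and C2: "C2_on v ({0<..<1} - {s})"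
    and ode: "satisfies_ode_on \<omega> \<mu> f0 l ({0<..<1} - {s}) v"
    using v by (auto simp: fb_solution_def)
  have v1: "v 1 = 0" and cv: "continuous_on {0..1} v" using adm by (auto simp: admissible_def)
  have "C1_on v {0..<1}" "(v has_real_derivative 0) (at 0 within {0..<1})"
    using adm by (auto simp: admissible_def)
  then obtain u' where u': "\<And>x. x \<in> {0<..<1} \<Longrightarrow> DERIV v x :> u' x"
    "continuous_on {0..<1} u'" "u' 0 = 0"
    using C1_on_deriv_at_0 by metis
  have S: "open ({0<..<1} - {s})" by (simp add: open_Diff)
  have ddv: "DERIV u' x :> \<omega>\<^sup>2 * v x - l * coalb f0 \<mu> (v x)" if "x \<in> {0<..<1} - {s}" for x
    using second_order_ode(1)[OF S _ C2 ode u'(1) that] by auto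
  have inner: "v x = inner l s x" if "x \<in> {0..s}" for x
  proof (cases "s = 0")
    case False
    have eq: "v x = (v 0 - l / \<omega>\<^sup>2) * cosh (\<omega> * (x - 0)) + u' 0 / \<omega> * sinh (\<omega> * (x - 0)) + l / \<omega>\<^sup>2"
      if "x \<in> {0..s}" for x
    proof (rule linear_ode_solution[OF _ _ _ _ _ _ that])
      show "continuous_on {0..s} v" "continuous_on {0..<s} u'"
        using s by (auto intro: continuous_on_subset[OF cv] continuous_on_subset[OF u'(2)])
      fix x assume x: "0 < x" "x < s"
      then show "DERIV v x :> u' x" using u'(1) s by simp
      have "\<mu> \<le> v x" using monotone_sol_antimono[OF adm mono, of x s] x s by simp
      then show "DERIV u' x :> \<omega>\<^sup>2 * v x - l" using ddv[of x] x s by (simp add: coalb_eq)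
    qed (use \<omega>_pos s False in auto)
    have "v 0 - l / \<omega>\<^sup>2 = (\<mu> - l / \<omega>\<^sup>2) / cosh (\<omega> * s)"
      using eq[of s] s u'(3) by (simp add: field_simps)
    then show ?thesis using eq[OF that] u'(3) by (simp add: inner_def)
  qed (use that s inner_s[of l s] in simp)
  \<comment> \<open>The slope at \<open>s\<close> is computed from the left, where \<open>v\<close>
    is already known, and becomes the initial slope on the right; for \<open>s = 0\<close> it is the
    Neumann condition.\<close>
  have "u' s = inner' l s s"
  proof (cases "s = 0")
    case False
    then have "(v has_real_derivative u' s) (at s within {0..s})"
      using s by (intro has_field_derivative_at_within[OF u'(1)]) simp
    then have "(inner l s has_real_derivative u' s) (at s within {0..s})"
      by (rule has_field_derivative_transform_within[where d = 1]) (use inner s in auto)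
    moreover have "(inner l s has_real_derivative inner' l s s) (at s within {0..s})"
      by (rule has_field_derivative_at_within[OF DERIV_inner])
    moreover have "at s within {0..s} \<noteq> bot"
      using False s by (simp add: trivial_limit_within islimpt_Icc)
    ultimately show ?thesis by (rule has_field_derivative_unique)
  qed (simp add: u'(3) inner'_def)
  then have u's: "u' s / \<omega> = (\<mu> - l / \<omega>\<^sup>2) * tanh (\<omega> * s)"
    using \<omega>_pos by (simp add: inner'_s outer'_def)
  have outer: "v x = outer l s x" if "x \<in> {s..1}" for x
  proof -
    have "v x = (v s - l * f0 / \<omega>\<^sup>2) * cosh (\<omega> * (x - s)) + u' s / \<omega> * sinh (\<omega> * (x - s)) + l * f0 / \<omega>\<^sup>2"
    proof (rule linear_ode_solution[OF _ _ _ _ _ _ that])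
      show "continuous_on {s..1} v" "continuous_on {s..<1} u'"
        using s by (auto intro: continuous_on_subset[OF cv] continuous_on_subset[OF u'(2)])
      fix x assume x: "s < x" "x < 1"
      then show "DERIV v x :> u' x" using u'(1) s by simp
      have "v x < \<mu>" using fb_solution_less[OF l v mono] x by simp
      then show "DERIV u' x :> \<omega>\<^sup>2 * v x - l * f0" using ddv[of x] x s by (simp add: coalb_eq)
    qed (use \<omega>_pos s in auto)
    then show ?thesis unfolding u's outer_def s(3) .
  qed
  show "l = \<Lambda> s" using outer[of 1] v1 s outer_1_eq_0_iff[of s l] by simp
  show "v x = profile l s x" if "x \<in> {0..1}" for x
    using inner[of x] outer[of x] that by (simp add: profile_def)
qed

subsection \<open>The bifurcation diagram\<close>

text \<open>\<open>xL\<close> and \<open>xU\<close> invert \<open>D\<close> rather than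
  \<open>\<Lambda>\<close>: \<open>D\<close> is continuous and injective on both compact intervals,
  including the endpoint 1 where \<open>\<lambda>\<close> would be infinite, so compactness makes
  the inverses continuous.\<close>

definition xL where "xL l = inv_into {0..r} D (\<mu> * \<omega>\<^sup>2 * cosh \<omega> / l)"

definition xU where "xU l = inv_into {r..1} D (\<mu> * \<omega>\<^sup>2 * cosh \<omega> / l)"

lemma inj_on_D_left: "inj_on D {0..r}" and inj_on_D_right: "inj_on D {r..1}"
  using D_less_left D_less_right by (auto intro!: linorder_inj_onI' simp: less_imp_neq less_imp_neq[symmetric])

lemma image_D_left: "D ` {0..r} = {D 0..D r}"
proof (intro antisym subsetI)
  fix d assume "d \<in> {D 0..D r}"
  then have "\<exists>s. 0 \<le> s \<and> s \<le> r \<and> D s = d"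
    using r by (intro IVT' continuous_on_D) auto
  then show "d \<in> D ` {0..r}" by auto
next
  fix d assume "d \<in> D ` {0..r}"
  then obtain s where s: "d = D s" "0 \<le> s" "s \<le> r" by auto
  then have "D 0 \<le> D s" using D_less_left[of 0 s] by (cases "s = 0") auto
  then show "d \<in> {D 0..D r}" using s D_le_r by simp
qed

lemma image_D_right: "D ` {r..1} = {0..D r}"
proof (intro antisym subsetI)
  fix d assume "d \<in> {0..D r}"
  then have "\<exists>s. r \<le> s \<and> s \<le> 1 \<and> D s = d"
    using r D_1 by (intro IVT2' continuous_on_D) auto
  then show "d \<in> D ` {r..1}" by auto
next
  fix d assume "d \<in> D ` {r..1}"
  then obtain s where s: "d = D s" "r \<le> s" "s \<le> 1" by auto
  then have "0 \<le> D s" using D_pos[of s] r D_1 by (cases "s = 1") auto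
  then show "d \<in> {0..D r}" using s D_le_r by simp
qed

lemma \<Lambda>_r_pos: "0 < \<Lambda> r" and \<Lambda>_r_less: "\<Lambda> r < \<Lambda> 0"
  using \<Lambda>_pos[of r] r \<Lambda>_less_iff[of r 0] D_less_r[of 0] by auto

lemma le_\<Lambda>_iff:
  assumes "0 < l" "0 \<le> s" "s < 1"
  shows "D s \<le> \<mu> * \<omega>\<^sup>2 * cosh \<omega> / l \<longleftrightarrow> l \<le> \<Lambda> s" and "\<mu> * \<omega>\<^sup>2 * cosh \<omega> / l \<le> D s \<longleftrightarrow> \<Lambda> s \<le> l"
    and "D s = \<mu> * \<omega>\<^sup>2 * cosh \<omega> / l \<longleftrightarrow> l = \<Lambda> s"
  using D_pos[OF assms(2,3)] assms(1) by (auto simp: \<Lambda>_def field_simps)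

lemma xL: assumes "\<Lambda> r \<le> l" "l \<le> \<Lambda> 0"
  shows "xL l \<in> {0..r}" "\<Lambda> (xL l) = l"
proof -
  have l: "0 < l" using assms \<Lambda>_r_pos by simp
  have q: "\<mu> * \<omega>\<^sup>2 * cosh \<omega> / l \<in> D ` {0..r}"
    unfolding image_D_left using le_\<Lambda>_iff(1)[OF l, of 0] le_\<Lambda>_iff(2)[OF l, of r] assms r by simp
  show in0: "xL l \<in> {0..r}" unfolding xL_def by (rule inv_into_into[OF q])
  have "D (xL l) = \<mu> * \<omega>\<^sup>2 * cosh \<omega> / l" unfolding xL_def by (rule f_inv_into_f[OF q])
  then show "\<Lambda> (xL l) = l" using le_\<Lambda>_iff(3)[OF l, of "xL l"] in0 r by simp
qed

lemma xU: assumes "\<Lambda> r \<le> l"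
  shows "xU l \<in> {r..<1}" "\<Lambda> (xU l) = l"
proof -
  have l: "0 < l" using assms \<Lambda>_r_pos by simp
  have q0: "0 < \<mu> * \<omega>\<^sup>2 * cosh \<omega> / l" using l \<mu>_pos \<omega>_pos by simp
  then have q: "\<mu> * \<omega>\<^sup>2 * cosh \<omega> / l \<in> D ` {r..1}"
    unfolding image_D_right using le_\<Lambda>_iff(2)[OF l, of r] assms r by simp
  have in1: "xU l \<in> {r..1}" unfolding xU_def by (rule inv_into_into[OF q])
  have D: "D (xU l) = \<mu> * \<omega>\<^sup>2 * cosh \<omega> / l" unfolding xU_def by (rule f_inv_into_f[OF q])
  \<comment> \<open>The endpoint 1 would give \<open>D = 0\<close>, which no finite \<open>l\<close>
    reaches.\<close>
  then have "xU l \<noteq> 1" using q0 D_1 by auto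
  then show in0: "xU l \<in> {r..<1}" using in1 by simp
  show "\<Lambda> (xU l) = l" using le_\<Lambda>_iff(3)[OF l, of "xU l"] in0 r D by simp
qed

lemma xL_\<Lambda>: assumes "s \<in> {0..r}" shows "xL (\<Lambda> s) = s"
proof -
  have "D s = \<mu> * \<omega>\<^sup>2 * cosh \<omega> / \<Lambda> s"
    using le_\<Lambda>_iff(3)[of "\<Lambda> s" s] \<Lambda>_pos[of s] assms r by simp
  then show ?thesis unfolding xL_def using inv_into_f_f[OF inj_on_D_left assms] by simp
qed

lemma xU_\<Lambda>: assumes "s \<in> {r..<1}" shows "xU (\<Lambda> s) = s"
proof -
  have "D s = \<mu> * \<omega>\<^sup>2 * cosh \<omega> / \<Lambda> s"
    using le_\<Lambda>_iff(3)[of "\<Lambda> s" s] \<Lambda>_pos[of s] assms r by simp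
  then show ?thesis unfolding xU_def using inv_into_f_f[OF inj_on_D_right, of s] assms by simp
qed

lemma continuous_on_xL: "continuous_on {\<Lambda> r..\<Lambda> 0} xL"
proof -
  have "continuous_on (D ` {0..r}) (inv_into {0..r} D)"
    using inv_into_f_f[OF inj_on_D_left] by (intro continuous_on_inv continuous_on_D) auto
  moreover have "continuous_on {\<Lambda> r..\<Lambda> 0} (\<lambda>l. \<mu> * \<omega>\<^sup>2 * cosh \<omega> / l)"
    using \<Lambda>_r_pos by (intro continuous_intros) auto
  moreover have "(\<lambda>l. \<mu> * \<omega>\<^sup>2 * cosh \<omega> / l) ` {\<Lambda> r..\<Lambda> 0} \<subseteq> D ` {0..r}"
    unfolding image_D_left using le_\<Lambda>_iff(1)[of _ 0] le_\<Lambda>_iff(2)[of _ r] \<Lambda>_r_pos r by auto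
  ultimately show ?thesis unfolding xL_def by (rule continuous_on_compose2)
qed

lemma continuous_on_xU: "continuous_on {\<Lambda> r..} xU"
proof -
  have "continuous_on (D ` {r..1}) (inv_into {r..1} D)"
    using inv_into_f_f[OF inj_on_D_right] by (intro continuous_on_inv continuous_on_D) auto
  moreover have "continuous_on {\<Lambda> r..} (\<lambda>l. \<mu> * \<omega>\<^sup>2 * cosh \<omega> / l)"
    using \<Lambda>_r_pos by (intro continuous_intros) auto
  moreover have "(\<lambda>l. \<mu> * \<omega>\<^sup>2 * cosh \<omega> / l) ` {\<Lambda> r..} \<subseteq> D ` {r..1}"
    unfolding image_D_right using le_\<Lambda>_iff(2)[of _ r] \<Lambda>_r_pos r \<mu>_pos \<omega>_pos by auto
  ultimately show ?thesis unfolding xU_def by (rule continuous_on_compose2)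
qed

lemma xL_bounds:
  assumes "l \<in> {\<Lambda> r<..\<Lambda> 0}"
  shows "0 \<le> xL l" "xL l < r" "xL l < 1" "l < \<Lambda> 0 \<Longrightarrow> 0 < xL l" "l = \<Lambda> (xL l)"
proof -
  show l: "l = \<Lambda> (xL l)" using xL(2)[of l] assms by simp
  then have ne: "xL l \<noteq> r" using assms by auto
  show "0 \<le> xL l" "xL l < r" using xL(1)[of l] assms ne by auto
  then show "xL l < 1" using r by simp
  show "0 < xL l" if "l < \<Lambda> 0"
    using l that xL(1)[of l] assms by (cases "xL l = 0") auto
qed

lemma xU_bounds:
  assumes "\<Lambda> r < l"
  shows "r < xU l" "0 \<le> xU l" "xU l < 1" "l = \<Lambda> (xU l)"
proof -
  show l: "l = \<Lambda> (xU l)" using xU(2)[of l] assms by simp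
  then have ne: "xU l \<noteq> r" using assms by auto
  then show "r < xU l" using xU(1)[of l] assms by auto
  then show "0 \<le> xU l" using r by simp
  show "xU l < 1" using xU(1)[of l] assms by auto
qed

lemma xL_less: assumes "\<Lambda> r \<le> l" "l < l'" "l' \<le> \<Lambda> 0" shows "xL l' < xL l"
proof (rule ccontr)
  assume "\<not> ?thesis"
  then have "D (xL l) \<le> D (xL l')"
    using D_less_left[of "xL l" "xL l'"] xL(1)[of l'] assms by (cases "xL l = xL l'") auto
  then show False
    using \<Lambda>_less_iff[of "xL l" "xL l'"] xL[of l] xL[of l'] assms r by auto
qed

lemma xU_less: assumes "\<Lambda> r \<le> l" "l < l'" shows "xU l < xU l'"
proof (rule ccontr)
  assume "\<not> ?thesis"
  then have "D (xU l) \<le> D (xU l')"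
    using D_less_right[of "xU l'" "xU l"] xU(1)[of l'] assms by (cases "xU l = xU l'") auto
  then show False
    using \<Lambda>_less_iff[of "xU l" "xU l'"] xU[of l] xU[of l'] assms r by auto
qed

lemma gamma_fb_\<Gamma>: "l = \<Lambda> s \<Longrightarrow> gamma_fb \<omega> \<mu> l s = \<Gamma> s"
  by (simp add: \<Gamma>_def)

text \<open>Uniqueness yields one inclusion, the explicit solutions the other. The parameter
  \<open>s\<close> keeps the turning point inside a single arc, which suits the continuity of the
  curve.\<close>

lemma bifurcation_diagram_eq:
  "bifurcation_diagram \<omega> \<mu> f0 =
    (\<lambda>l. (l, gamma_star \<omega> f0 l)) ` {0<..<\<Lambda> 0} \<union> (\<lambda>s. (\<Lambda> s, \<Gamma> s)) ` {0..<1}"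
proof (intro antisym subsetI)
  fix z assume "z \<in> bifurcation_diagram \<omega> \<mu> f0"
  then obtain l u where z: "z = (l, supnorm u)" and l: "0 < l" and mono: "monotone_sol u"
    and u: "nofb_solution \<omega> \<mu> f0 l u \<or> (\<exists>s. fb_solution \<omega> \<mu> f0 l u s)"
    unfolding bifurcation_diagram_def by blast
  from u show "z \<in> (\<lambda>l. (l, gamma_star \<omega> f0 l)) ` {0<..<\<Lambda> 0} \<union> (\<lambda>s. (\<Lambda> s, \<Gamma> s)) ` {0..<1}"
  proof (elim disjE exE)
    assume nofb: "nofb_solution \<omega> \<mu> f0 l u"
    then have "supnorm u = u 0" using mono by (intro supnorm_monotone_sol) (auto simp: nofb_solution_def)
    then have "supnorm u = gamma_star \<omega> f0 l" using nofb_solution_unique(1)[OF l nofb, of 0] cold_0 by simp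
    then show ?thesis using nofb_solution_unique(2)[OF l nofb] l z by auto
  next
    fix s assume fb: "fb_solution \<omega> \<mu> f0 l u s"
    then have s: "s \<in> {0..<1}" and "supnorm u = u 0"
      using mono by (auto simp: fb_solution_def intro!: supnorm_monotone_sol)
    then have "supnorm u = \<Gamma> s"
      using fb_solution_unique[OF l fb mono] profile_0[of s l] gamma_fb_\<Gamma>[of l s] by simp
    then show ?thesis using fb_solution_unique(1)[OF l fb mono] s z by auto
  qed
next
  fix z assume "z \<in> (\<lambda>l. (l, gamma_star \<omega> f0 l)) ` {0<..<\<Lambda> 0} \<union> (\<lambda>s. (\<Lambda> s, \<Gamma> s)) ` {0..<1}"
  then show "z \<in> bifurcation_diagram \<omega> \<mu> f0"
  proof (elim UnE imageE)
    fix l assume z: "z = (l, gamma_star \<omega> f0 l)" and l: "l \<in> {0<..<\<Lambda> 0}"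
    then have "z = (l, supnorm (cold l))"
      using supnorm_monotone_sol[OF cold_admissible cold_monotone] cold_0 by simp
    moreover have "nofb_solution \<omega> \<mu> f0 l (cold l)" "monotone_sol (cold l)"
      using l by (auto intro: cold_nofb_solution cold_monotone)
    ultimately show ?thesis using l unfolding bifurcation_diagram_def by auto
  next
    fix s assume z: "z = (\<Lambda> s, \<Gamma> s)" and "s \<in> {0..<1}"
    then have s: "0 \<le> s" "s < 1" by auto
    have "z = (\<Lambda> s, supnorm (profile (\<Lambda> s) s))"
      using z supnorm_profile[OF s refl] profile_0[OF s(1)] gamma_fb_\<Gamma>[OF refl] by simp
    then show ?thesis
      using profile_fb_solution[OF s refl] profile_monotone[OF s refl] \<Lambda>_pos[OF s]
      unfolding bifurcation_diagram_def by blast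
  qed
qed

text \<open>Cuts the arc at \<open>r\<close>. Both branches are open at \<open>\<Lambda> r\<close>,
  so the turning point appears as a singleton; \<open>s = 0\<close> accounts for the closed end at
  \<open>\<Lambda> 0\<close>.\<close>

lemma \<Lambda>_\<Gamma>_image:
  "(\<lambda>s. (\<Lambda> s, \<Gamma> s)) ` {0..<1} =
    (\<lambda>l. (l, gamma_fb \<omega> \<mu> l (xL l))) ` {\<Lambda> r<..\<Lambda> 0} \<union> {(\<Lambda> r, \<Gamma> r)} \<union>
    (\<lambda>l. (l, gamma_fb \<omega> \<mu> l (xU l))) ` {\<Lambda> r<..}"
  (is "?A = ?L \<union> {?R} \<union> ?U")
proof (intro antisym subsetI)
  fix z assume "z \<in> ?A"
  then obtain s where s: "0 \<le> s" "s < 1" and z: "z = (\<Lambda> s, \<Gamma> s)" by auto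
  have gt: "s \<noteq> r \<Longrightarrow> \<Lambda> r < \<Lambda> s" using \<Lambda>_less_iff[of r s] D_less_r[of s] s r by simp
  consider "s < r" | "s = r" | "r < s" by linarith
  then show "z \<in> ?L \<union> {?R} \<union> ?U"
  proof cases
    case 1
    then have "D 0 \<le> D s" using D_less_left[of 0 s] s by (cases "s = 0") auto
    then have "\<Lambda> s \<le> \<Lambda> 0" using \<Lambda>_less_iff[of 0 s] s by simp
    then have "z = (\<lambda>l. (l, gamma_fb \<omega> \<mu> l (xL l))) (\<Lambda> s)" "\<Lambda> s \<in> {\<Lambda> r<..\<Lambda> 0}"
      using z xL_\<Lambda>[of s] s 1 gt by (auto simp: \<Gamma>_def)
    then show ?thesis by blast
  next
    case 2
    then show ?thesis using z by simp
  next
    case 3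
    then have "z = (\<lambda>l. (l, gamma_fb \<omega> \<mu> l (xU l))) (\<Lambda> s)" "\<Lambda> s \<in> {\<Lambda> r<..}"
      using z xU_\<Lambda>[of s] s gt by (auto simp: \<Gamma>_def)
    then show ?thesis by blast
  qed
next
  fix z assume "z \<in> ?L \<union> {?R} \<union> ?U"
  then show "z \<in> ?A"
  proof (elim UnE imageE)
    fix l assume "z = (l, gamma_fb \<omega> \<mu> l (xL l))" and l: "l \<in> {\<Lambda> r<..\<Lambda> 0}"
    then have "z = (\<Lambda> (xL l), \<Gamma> (xL l))" using xL_bounds(5)[OF l] gamma_fb_\<Gamma> by metis
    then show ?thesis using xL_bounds[OF l] by auto
  next
    fix l assume "z = (l, gamma_fb \<omega> \<mu> l (xU l))" and "l \<in> {\<Lambda> r<..}"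
    then have "\<Lambda> r < l" "z = (\<Lambda> (xU l), \<Gamma> (xU l))" using xU_bounds(4)[of l] gamma_fb_\<Gamma>[of l "xU l"] by auto
    then show ?thesis using xU_bounds[of l] by auto
  qed (use r in auto)
qed

section \<open>The diagram as one continuous curve\<close>

lemma continuous_on_\<Lambda>: "continuous_on {0..<1} \<Lambda>"
  unfolding \<Lambda>_def using D_pos by (intro continuous_intros continuous_on_D) force

lemma continuous_on_gamma_star: "continuous_on X (gamma_star \<omega> f0)"
  unfolding gamma_star_def using \<omega>_pos by (intro continuous_intros) auto

text \<open>The cold branch is parametrised by \<open>\<lambda>\<close>; the branch of solutions with free boundary
  \<open>s \<in> [0,1)\<close> follows it, with \<open>s = (t - \<lambda>\<^sub>2) / (1 + t - \<lambda>\<^sub>2)\<close>.\<close>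

lemma continuous_curve_bifurcation_diagram: "continuous_curve (bifurcation_diagram \<omega> \<mu> f0)"
proof -
  define \<sigma> where "\<sigma> t = (t - \<Lambda> 0) / (1 + (t - \<Lambda> 0))" for t
  have \<sigma>: "0 \<le> \<sigma> t" "\<sigma> t < 1" if "\<Lambda> 0 \<le> t" for t
    using that by (auto simp: \<sigma>_def)
  have \<sigma>_pos: "0 < \<sigma> t" if "\<Lambda> 0 < t" for t
    using that by (auto simp: \<sigma>_def)
  have \<sigma>_inj: "t = t'" if "\<Lambda> 0 \<le> t" "\<Lambda> 0 \<le> t'" "\<sigma> t = \<sigma> t'" for t t'
    using that unfolding \<sigma>_def by (simp add: frac_eq_eq algebra_simps)
  have \<sigma>_0: "\<sigma> (\<Lambda> 0) = 0" by (simp add: \<sigma>_def)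
  have \<Gamma>_gt: "\<mu> < \<Gamma> (\<sigma> t)" if "\<Lambda> 0 < t" for t
    using \<Gamma>_less[of 0 "\<sigma> t"] \<Gamma>_0 \<sigma>_pos[OF that] \<sigma>(2)[of t] that by simp
  define p where "p t = (if t \<le> \<Lambda> 0 then (t, gamma_star \<omega> f0 t) else (\<Lambda> (\<sigma> t), \<Gamma> (\<sigma> t)))" for t
  have star_\<Lambda>_0: "gamma_star \<omega> f0 (\<Lambda> 0) = \<mu>" using \<Lambda>_0_pos by (simp add: gamma_star_eq)
  have "continuous_on {0<..} p"
    unfolding p_def
  proof (rule continuous_on_cases_le)
    show "continuous_on {t \<in> {0<..}. t \<le> \<Lambda> 0} (\<lambda>t. (t, gamma_star \<omega> f0 t))"
      by (intro continuous_intros continuous_on_gamma_star)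
    have c\<sigma>: "continuous_on {t \<in> {0<..}. \<Lambda> 0 \<le> t} \<sigma>"
      unfolding \<sigma>_def by (intro continuous_intros) auto
    show "continuous_on {t \<in> {0<..}. \<Lambda> 0 \<le> t} (\<lambda>t. (\<Lambda> (\<sigma> t), \<Gamma> (\<sigma> t)))"
      by (intro continuous_on_Pair continuous_on_compose2[OF continuous_on_\<Lambda> c\<sigma>]
          continuous_on_compose2[OF continuous_on_\<Gamma>[OF order_refl] c\<sigma>]) (use \<sigma> in auto)
  qed (auto intro: continuous_intros simp: \<sigma>_0 \<Gamma>_0 star_\<Lambda>_0)
  moreover have "inj_on p {0<..}"
  proof (rule inj_onI)
    fix t t' assume t: "t \<in> {0<..}" "t' \<in> {0<..}" and eq: "p t = p t'"
    \<comment> \<open>The two pieces overlap in \<open>\<lambda>\<close>, so it is the norm that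
      separates them: at most \<open>\<mu>\<close> on the line, above \<open>\<mu>\<close> after
      it.\<close>
    have star: "gamma_star \<omega> f0 t \<le> \<mu>" if "t \<le> \<Lambda> 0" for t
      using gamma_star_mono[of t "\<Lambda> 0"] star_\<Lambda>_0 that by (cases "t = \<Lambda> 0") auto
    show "t = t'"
    proof (cases "t \<le> \<Lambda> 0"; cases "t' \<le> \<Lambda> 0")
      assume "\<not> t \<le> \<Lambda> 0" "\<not> t' \<le> \<Lambda> 0"
      then have "\<sigma> t = \<sigma> t'"
        using eq \<Gamma>_less[of "\<sigma> t" "\<sigma> t'"] \<Gamma>_less[of "\<sigma> t'" "\<sigma> t"] \<sigma>[of t] \<sigma>[of t']
        by (cases "\<sigma> t" "\<sigma> t'" rule: linorder_cases) (auto simp: p_def)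
      then show ?thesis using \<sigma>_inj \<open>\<not> t \<le> \<Lambda> 0\<close> \<open>\<not> t' \<le> \<Lambda> 0\<close> by simp
    qed (use eq star[of t] star[of t'] \<Gamma>_gt[of t] \<Gamma>_gt[of t'] in \<open>auto simp: p_def\<close>)
  qed
  moreover have "p ` {0<..} = bifurcation_diagram \<omega> \<mu> f0"
    unfolding bifurcation_diagram_eq
  proof (intro antisym subsetI)
    fix z assume "z \<in> p ` {0<..}"
    then obtain t where t: "0 < t" "z = p t" by auto
    consider "t < \<Lambda> 0" | "t = \<Lambda> 0" | "\<Lambda> 0 < t" by linarith
    then show "z \<in> (\<lambda>l. (l, gamma_star \<omega> f0 l)) ` {0<..<\<Lambda> 0} \<union> (\<lambda>s. (\<Lambda> s, \<Gamma> s)) ` {0..<1}"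
    proof cases
      case 2
      then have "z = (\<Lambda> 0, \<Gamma> 0)" using t by (simp add: p_def star_\<Lambda>_0 \<Gamma>_0)
      then show ?thesis by auto
    qed (use t \<sigma> in \<open>auto simp: p_def\<close>)
  next
    fix z assume "z \<in> (\<lambda>l. (l, gamma_star \<omega> f0 l)) ` {0<..<\<Lambda> 0} \<union> (\<lambda>s. (\<Lambda> s, \<Gamma> s)) ` {0..<1}"
    then show "z \<in> p ` {0<..}"
    proof (elim UnE imageE)
      fix l assume "z = (l, gamma_star \<omega> f0 l)" "l \<in> {0<..<\<Lambda> 0}"
      then have "z = p l" "l \<in> {0<..}" by (auto simp: p_def)
      then show ?thesis by blast
    next
      fix s assume z: "z = (\<Lambda> s, \<Gamma> s)" and s: "s \<in> {0..<1}"
      define t where "t = \<Lambda> 0 + s / (1 - s)"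
      have t: "\<Lambda> 0 \<le> t" "0 < t" using s \<Lambda>_0_pos by (auto simp: t_def add_pos_nonneg)
      have \<sigma>t: "\<sigma> t = s" using s by (simp add: \<sigma>_def t_def field_simps)
      have "z = p t"
      proof (cases "t = \<Lambda> 0")
        case True
        then have "s = 0" using \<sigma>t \<sigma>_0 by simp
        then show ?thesis using z True by (simp add: p_def star_\<Lambda>_0 \<Gamma>_0)
      qed (use z \<sigma>t t in \<open>simp add: p_def\<close>)
      then show ?thesis using t by auto
    qed
  qed
  ultimately show ?thesis unfolding continuous_curve_def by blast
qed

section \<open>Continuity and monotonicity of the two branches in \<open>\<lambda>\<close>\<close>

lemma continuous_on_gamma_xL: "continuous_on {\<Lambda> r<..\<Lambda> 0} (\<lambda>l. gamma_fb \<omega> \<mu> l (xL l))"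
proof -
  have "continuous_on {\<Lambda> r<..\<Lambda> 0} xL" by (rule continuous_on_subset[OF continuous_on_xL]) auto
  then show ?thesis unfolding gamma_fb_def using \<omega>_pos by (intro continuous_intros) auto
qed

lemma continuous_on_gamma_xU: "continuous_on {\<Lambda> r<..} (\<lambda>l. gamma_fb \<omega> \<mu> l (xU l))"
proof -
  have "continuous_on {\<Lambda> r<..} xU" by (rule continuous_on_subset[OF continuous_on_xU]) auto
  then show ?thesis unfolding gamma_fb_def using \<omega>_pos by (intro continuous_intros) auto
qed

lemma gamma_xL_antimono: "strict_antimono_on {\<Lambda> r<..\<Lambda> 0} (\<lambda>l. gamma_fb \<omega> \<mu> l (xL l))"
proof (rule monotone_onI)
  fix l l' assume l: "l \<in> {\<Lambda> r<..\<Lambda> 0}" "l' \<in> {\<Lambda> r<..\<Lambda> 0}" "l < l'"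
  then have "\<Gamma> (xL l') < \<Gamma> (xL l)"
    using xL_less[of l l'] xL_bounds[OF l(1)] xL_bounds[OF l(2)] by (intro \<Gamma>_less) auto
  then show "gamma_fb \<omega> \<mu> l' (xL l') < gamma_fb \<omega> \<mu> l (xL l)"
    using gamma_fb_\<Gamma>[OF xL_bounds(5)[OF l(1)]] gamma_fb_\<Gamma>[OF xL_bounds(5)[OF l(2)]] by simp
qed

lemma gamma_xU_mono: "strict_mono_on {\<Lambda> r<..} (\<lambda>l. gamma_fb \<omega> \<mu> l (xU l))"
proof (rule strict_mono_onI)
  fix l l' assume l: "l \<in> {\<Lambda> r<..}" "l' \<in> {\<Lambda> r<..}" "l < l'"
  then have l': "\<Lambda> r < l" "\<Lambda> r < l'" by auto
  have "\<Gamma> (xU l) < \<Gamma> (xU l')"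
    using xU_less[of l l'] l xU_bounds[OF l'(1)] xU_bounds[OF l'(2)] by (intro \<Gamma>_less) auto
  then show "gamma_fb \<omega> \<mu> l (xU l) < gamma_fb \<omega> \<mu> l' (xU l')"
    using gamma_fb_\<Gamma>[OF xU_bounds(4)[OF l'(1)]] gamma_fb_\<Gamma>[OF xU_bounds(4)[OF l'(2)]] by simp
qed

text \<open>Strict maximality of \<open>D\<close> at \<open>r\<close> lets \<open>\<Lambda>\<close>
  take its least value only there.\<close>

lemma fb_solution_\<Lambda>_r_unique:
  assumes "fb_solution \<omega> \<mu> f0 (\<Lambda> r) v s" "monotone_sol v"
  shows "s = r \<and> (\<forall>x\<in>{0..1}. v x = profile (\<Lambda> r) r x)"
proof -
  have "\<Lambda> r = \<Lambda> s" by (rule fb_solution_unique(1)[OF \<Lambda>_r_pos assms])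
  moreover have "0 \<le> s" "s < 1" using assms(1) by (auto simp: fb_solution_def)
  ultimately have "s = r" using \<Lambda>_less_iff[of r s] r D_less_r[of s] by auto
  then show ?thesis using fb_solution_unique(2)[OF \<Lambda>_r_pos assms] by simp
qed

text \<open>At \<open>\<Lambda> 0\<close> the upper branch supplies a second monotone solution, with
  norm above \<open>\<mu>\<close>; the condition \<open>v 0 = \<mu>\<close> singles out
  \<open>s = 0\<close> because \<open>\<Gamma>\<close> is strictly increasing.\<close>

lemma fb_solution_\<Lambda>_0_unique:
  assumes "fb_solution \<omega> \<mu> f0 (\<Lambda> 0) v s" "monotone_sol v" "v 0 = \<mu>"
  shows "s = 0 \<and> (\<forall>x\<in>{0..1}. v x = profile (\<Lambda> 0) 0 x)"
proof -
  note u = fb_solution_unique[OF \<Lambda>_0_pos assms(1,2)]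
  have s: "0 \<le> s" "s < 1" using assms(1) by (auto simp: fb_solution_def)
  have "\<Gamma> s = \<mu>" using u(2)[of 0] assms(3) profile_0[OF s(1)] gamma_fb_\<Gamma>[OF u(1)] by simp
  then have "s = 0" using \<Gamma>_less[of 0 s] \<Gamma>_0 s by (cases "s = 0") auto
  then show ?thesis using u(2) by simp
qed

text \<open>The concavity criterion at \<open>\<Lambda> 0\<close>; it amounts to
  \<open>cosh \<omega> - 1 \<le> cosh \<omega>\<close>.\<close>

lemma \<mu>_le_\<Lambda>_0: "\<mu> * \<omega>\<^sup>2 \<le> \<Lambda> 0 * f0"
proof -
  have "1 \<le> cosh \<omega> / (cosh \<omega> - 1)" using cosh_\<omega>_gt_1 by simp
  then have "\<mu> * \<omega>\<^sup>2 * 1 \<le> \<mu> * \<omega>\<^sup>2 * (cosh \<omega> / (cosh \<omega> - 1))"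
    using \<mu>_pos by (intro mult_left_mono) auto
  then show ?thesis using f0_pos by (simp add: \<Lambda>_def D_0)
qed

end

text \<open>At \<open>l1\<close> the profile is strictly concave up to \<open>r\<close> in any case;
  beyond \<open>r\<close> this depends on the sign of
  \<open>\<mu> * \<omega>\<^sup>2 - l1 * f0\<close>, hence the equivalence. The free boundary
  \<open>xL\<close> reaches 0 at \<open>l2\<close>, so it is positive only for
  \<open>l < l2\<close>.\<close>

theorem theorem1p1:
  fixes \<omega> \<mu> f0 :: real
  assumes "0 < \<omega>" and "0 < \<mu>" and "0 < f0" and "f0 < 1"
  defines "r \<equiv> rstar \<omega> f0" and "l1 \<equiv> lam1 \<omega> \<mu> f0" and "l2 \<equiv> lam2 \<omega> \<mu> f0"
  shows
    \<comment> \<open>(i)\<close>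
    "(\<forall>l. 0 < l \<and> l < l2 \<longrightarrow>
        (\<exists>u. nofb_solution \<omega> \<mu> f0 l u \<and>
             (\<forall>v. nofb_solution \<omega> \<mu> f0 l v \<longrightarrow> (\<forall>x\<in>{0..1}. v x = u x)) \<and>
             monotone_sol u \<and> supnorm u = u 0 \<and>
             u 0 = - (l * f0) / (\<omega>\<^sup>2 * cosh \<omega>) + l * f0 / \<omega>\<^sup>2 \<and>
             u 0 = gamma_star \<omega> f0 l \<and> u 0 < \<mu>)) \<and>
     (\<lambda>l. (l, gamma_star \<omega> f0 l)) ` {0<..<l2} \<subseteq> bifurcation_diagram \<omega> \<mu> f0 \<and>
     strict_mono_on {0<..<l2} (gamma_star \<omega> f0) \<and>
     0 < l1 \<and> l1 < l2 \<and>
     (\<exists>u1 uL xL uU xU.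
        \<comment> \<open>(ii), at l1\<close>
        fb_solution \<omega> \<mu> f0 l1 u1 r \<and> monotone_sol u1 \<and>
        (\<forall>v xf. fb_solution \<omega> \<mu> f0 l1 v xf \<and> monotone_sol v \<longrightarrow>
            xf = r \<and> (\<forall>x\<in>{0..1}. v x = u1 x)) \<and>
        \<mu> < u1 0 \<and> strict_concave_on {0..r} u1 \<and>
        (strict_concave_on {0..1} u1 \<longleftrightarrow> \<mu> * \<omega>\<^sup>2 \<le> l1 * f0) \<and>
        \<comment> \<open>(ii), the solution with maximum \<open>\<mu>\<close>, at l2\<close>
        xL l2 = 0 \<and> uL l2 0 = \<mu> \<and> strict_concave_on {0..1} (uL l2) \<and>
        (\<forall>v xf. fb_solution \<omega> \<mu> f0 l2 v xf \<and> monotone_sol v \<and> v 0 = \<mu> \<longrightarrow>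
            xf = 0 \<and> (\<forall>x\<in>{0..1}. v x = uL l2 x)) \<and>
        \<comment> \<open>(iii)\<close>
        (\<forall>l\<in>{l1<..l2}.
            fb_solution \<omega> \<mu> f0 l (uL l) (xL l) \<and> monotone_sol (uL l) \<and>
            0 \<le> xL l \<and> (l < l2 \<longrightarrow> 0 < xL l) \<and> xL l < r \<and>
            supnorm (uL l) = uL l 0 \<and> uL l 0 = gamma_fb \<omega> \<mu> l (xL l)) \<and>
        \<comment> \<open>(iv)\<close>
        (\<forall>l\<in>{l1<..}.
            fb_solution \<omega> \<mu> f0 l (uU l) (xU l) \<and> monotone_sol (uU l) \<and>
            \<mu> < supnorm (uU l) \<and> (l \<le> l2 \<longrightarrow> supnorm (uL l) < supnorm (uU l)) \<and>
            r < xU l \<and> xU l < 1 \<and>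
            supnorm (uU l) = uU l 0 \<and> uU l 0 = gamma_fb \<omega> \<mu> l (xU l)) \<and>
        \<comment> \<open>(v)\<close>
        continuous_curve (bifurcation_diagram \<omega> \<mu> f0) \<and>
        bifurcation_diagram \<omega> \<mu> f0 =
          (\<lambda>l. (l, gamma_star \<omega> f0 l)) ` {0<..<l2} \<union>
          (\<lambda>l. (l, gamma_fb \<omega> \<mu> l (xL l))) ` {l1<..l2} \<union>
          {(l1, supnorm u1)} \<union>
          (\<lambda>l. (l, gamma_fb \<omega> \<mu> l (xU l))) ` {l1<..} \<and>
        continuous_on {0<..<l2} (gamma_star \<omega> f0) \<and>
        continuous_on {l1<..l2} (\<lambda>l. gamma_fb \<omega> \<mu> l (xL l)) \<and>
        continuous_on {l1<..} (\<lambda>l. gamma_fb \<omega> \<mu> l (xU l)) \<and>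
        strict_mono_on {0<..<l2} (gamma_star \<omega> f0) \<and>
        strict_antimono_on {l1<..l2} (\<lambda>l. gamma_fb \<omega> \<mu> l (xL l)) \<and>
        strict_mono_on {l1<..} (\<lambda>l. gamma_fb \<omega> \<mu> l (xU l)))"
proof -
  interpret P: heaviside_problem \<omega> \<mu> f0 by unfold_locales fact+
  have l1: "l1 = P.\<Lambda> r" and l2: "l2 = P.\<Lambda> 0"
    unfolding l1_def l2_def r_def by (rule P.lam1_eq P.lam2_eq)+
  note r = P.r[folded r_def]
  let ?uL = "\<lambda>l. P.profile l (P.xL l)" and ?uU = "\<lambda>l. P.profile l (P.xU l)" and ?u1 = "P.profile l1 r"
  have star_mono: "strict_mono_on {0<..<l2} (gamma_star \<omega> f0)"
    by (rule strict_mono_onI) (rule P.gamma_star_mono)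
  have cold: "\<exists>u. nofb_solution \<omega> \<mu> f0 l u \<and>
      (\<forall>v. nofb_solution \<omega> \<mu> f0 l v \<longrightarrow> (\<forall>x\<in>{0..1}. v x = u x)) \<and>
      monotone_sol u \<and> supnorm u = u 0 \<and>
      u 0 = - (l * f0) / (\<omega>\<^sup>2 * cosh \<omega>) + l * f0 / \<omega>\<^sup>2 \<and>
      u 0 = gamma_star \<omega> f0 l \<and> u 0 < \<mu>" if "0 < l \<and> l < l2" for l
  proof (intro exI[of _ "P.cold l"] conjI allI impI ballI)
    have l: "0 < l" "l < l2" using that by auto
    show "nofb_solution \<omega> \<mu> f0 l (P.cold l)" using l unfolding l2 by (rule P.cold_nofb_solution)
    show "v x = P.cold l x" if "nofb_solution \<omega> \<mu> f0 l v" "x \<in> {0..1}" for v x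
      using P.nofb_solution_unique(1)[OF l(1) that] .
    show "monotone_sol (P.cold l)" using l by (simp add: P.cold_monotone)
    then show "supnorm (P.cold l) = P.cold l 0"
      by (rule supnorm_monotone_sol[OF P.cold_admissible[OF l(1)]])
    show "P.cold l 0 = - (l * f0) / (\<omega>\<^sup>2 * cosh \<omega>) + l * f0 / \<omega>\<^sup>2" by (simp add: P.cold_def)
    show "P.cold l 0 = gamma_star \<omega> f0 l" by (rule P.cold_0)
    then show "P.cold l 0 < \<mu>" using l l2 by (simp add: P.gamma_star_less_iff)
  qed
  have sup1: "supnorm ?u1 = P.\<Gamma> r" and u1_0: "?u1 0 = P.\<Gamma> r"
    using P.supnorm_profile[of r l1] P.profile_0[of r l1] P.gamma_fb_\<Gamma>[OF l1] r l1 by simp_all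
  have part_i: "(\<lambda>l. (l, gamma_star \<omega> f0 l)) ` {0<..<l2} \<subseteq> bifurcation_diagram \<omega> \<mu> f0"
    unfolding P.bifurcation_diagram_eq l2 by (rule Un_upper1)
  have low: "fb_solution \<omega> \<mu> f0 l (?uL l) (P.xL l) \<and> monotone_sol (?uL l) \<and>
      0 \<le> P.xL l \<and> (l < l2 \<longrightarrow> 0 < P.xL l) \<and> P.xL l < r \<and>
      supnorm (?uL l) = ?uL l 0 \<and> ?uL l 0 = gamma_fb \<omega> \<mu> l (P.xL l)" if "l \<in> {l1<..l2}" for l
  proof -
    note b = P.xL_bounds[of l, folded r_def, folded l1 l2, OF that]
    show ?thesis
      using b P.profile_fb_solution[OF b(1,3,5)] P.profile_monotone[OF b(1,3,5)]
        P.supnorm_profile[OF b(1,3,5)] P.profile_0[OF b(1)] by blast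
  qed
  have up: "fb_solution \<omega> \<mu> f0 l (?uU l) (P.xU l) \<and> monotone_sol (?uU l) \<and>
      \<mu> < supnorm (?uU l) \<and> (l \<le> l2 \<longrightarrow> supnorm (?uL l) < supnorm (?uU l)) \<and>
      r < P.xU l \<and> P.xU l < 1 \<and>
      supnorm (?uU l) = ?uU l 0 \<and> ?uU l 0 = gamma_fb \<omega> \<mu> l (P.xU l)" if "l \<in> {l1<..}" for l
  proof -
    have "l1 < l" using that by simp
    note b = P.xU_bounds[of l, folded r_def, folded l1, OF this]
    have sup: "supnorm (?uU l) = ?uU l 0" "?uU l 0 = gamma_fb \<omega> \<mu> l (P.xU l)"
      by (rule P.supnorm_profile[OF b(2-4)]) (rule P.profile_0[OF b(2)])
    moreover have \<Gamma>: "gamma_fb \<omega> \<mu> l (P.xU l) = P.\<Gamma> (P.xU l)" by (rule P.gamma_fb_\<Gamma>[OF b(4)])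
    moreover have "\<mu> < P.\<Gamma> (P.xU l)" using P.\<Gamma>_less[of 0 "P.xU l"] P.\<Gamma>_0 b r by simp
    moreover have "supnorm (?uL l) < supnorm (?uU l)" if "l \<le> l2"
    proof -
      have l': "l \<in> {l1<..l2}" using that \<open>l1 < l\<close> by simp
      note c = P.xL_bounds[of l, folded r_def, folded l1 l2, OF l']
      have "supnorm (?uL l) = P.\<Gamma> (P.xL l)" using low[OF l'] P.gamma_fb_\<Gamma>[OF c(5)] by simp
      also have "\<dots> < P.\<Gamma> (P.xU l)" using b c by (intro P.\<Gamma>_less) auto
      finally show ?thesis using sup \<Gamma> by simp
    qed
    ultimately show ?thesis
      using b P.profile_fb_solution[OF b(2-4)] P.profile_monotone[OF b(2-4)] by auto
  qed
  have xL_l2: "P.xL l2 = 0" unfolding l2 using P.xL_\<Lambda>[of 0, folded r_def] r by simp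
  have uL_l2: "?uL l2 0 = \<mu>" "strict_concave_on {0..1} (?uL l2)"
    unfolding xL_l2 using P.profile_s[of l2 0] P.strict_concave_profile[OF _ _ l2] P.\<mu>_le_\<Lambda>_0 l2 by auto
  have r01: "0 \<le> r" "r < 1" using r by auto
  note u1 = P.profile_fb_solution[OF r01 l1] P.profile_monotone[OF r01 l1]
    P.strict_concave_profile_inner[OF r01 l1]
  have u1_unique: "\<forall>v xf. fb_solution \<omega> \<mu> f0 l1 v xf \<and> monotone_sol v \<longrightarrow>
      xf = r \<and> (\<forall>x\<in>{0..1}. v x = ?u1 x)"
    using P.fb_solution_\<Lambda>_r_unique[folded r_def, folded l1] by blast
  have u1_gt: "\<mu> < ?u1 0" unfolding u1_0 using P.\<Gamma>_less[of 0 r] P.\<Gamma>_0 r by simp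
  have u1_concave: "strict_concave_on {0..1} ?u1 \<longleftrightarrow> \<mu> * \<omega>\<^sup>2 \<le> l1 * f0"
    using P.strict_concave_profile[OF r01 l1] P.strict_concave_profileD[OF r01 l1] by blast
  have uL_l2_unique: "\<forall>v xf. fb_solution \<omega> \<mu> f0 l2 v xf \<and> monotone_sol v \<and> v 0 = \<mu> \<longrightarrow>
      xf = 0 \<and> (\<forall>x\<in>{0..1}. v x = ?uL l2 x)"
    unfolding xL_l2 using P.fb_solution_\<Lambda>_0_unique[folded l2] by blast
  have diagram: "bifurcation_diagram \<omega> \<mu> f0 =
      (\<lambda>l. (l, gamma_star \<omega> f0 l)) ` {0<..<l2} \<union>
      (\<lambda>l. (l, gamma_fb \<omega> \<mu> l (P.xL l))) ` {l1<..l2} \<union>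
      {(l1, supnorm ?u1)} \<union>
      (\<lambda>l. (l, gamma_fb \<omega> \<mu> l (P.xU l))) ` {l1<..}"
    unfolding sup1 unfolding P.bifurcation_diagram_eq P.\<Lambda>_\<Gamma>_image[folded r_def] l1 l2 by (simp only: Un_assoc)
  have order: "0 < l1" "l1 < l2"
    unfolding l1 l2 r_def by (rule P.\<Lambda>_r_pos P.\<Lambda>_r_less)+
  show ?thesis
    by (intro conjI exI5[where a = ?u1 and b = ?uL and c = P.xL and d = ?uU and e = P.xU]
        allI[OF impI[OF cold]] part_i star_mono order u1 u1_unique u1_gt u1_concave
        xL_l2 uL_l2 uL_l2_unique ballI[OF low] ballI[OF up] diagram
        P.continuous_curve_bifurcation_diagram P.continuous_on_gamma_star
        P.continuous_on_gamma_xL[folded r_def, folded l1 l2]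
        P.continuous_on_gamma_xU[folded r_def, folded l1]
        P.gamma_xL_antimono[folded r_def, folded l1 l2] P.gamma_xU_mono[folded r_def, folded l1]) simp_all
qed

end
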